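(* Let $f\in\mathcal F$ and let $g(\lambda)=h(\lambda)|t(\lambda)|^\alpha$, $\lambda\in\Lambda$, where $\alpha>0$, $h\in B_+^-$ and $t$ is a trigonometric polynomial not identically zero. Then $g\in\mathcal M_f$ and $fg\in\mathcal F$; in particular $\lim_{n\to\infty}\sigma_n^2(fg)/\sigma_n^2(f)=G(g)$. The same conclusion holds for $g(\lambda)=h(\lambda)|t_1(\lambda)|^{\alpha_1}\cdots|t_m(\lambda)|^{\alpha_m}$ with $h\in B_+^-$, $m\in\mathbb N$, $t_1,\dots,t_m$ trigonometric polynomials not identically zero and $\alpha_1,\dots,\alpha_m>0$.
   Context: $\Lambda=[-\pi,\pi]$. $G(h)=\exp\{\frac1{2\pi}\int_\Lambda\ln h\,d\lambda\}$ if $\ln h\in L^1(\Lambda)$, else $0$. $\sigma_n^2(f)=\min_{c_1,\dots,c_n\in\mathbb C}\int_\Lambda|1-\sum_{k=1}^n c_ke^{-ik\lambda}|^2f(\lambda)\,d\lambda$, $\sigma_n(f)=\sqrt{\sigma_n^2(f)}$. $\mathcal F=\{f\in L^1(\Lambda): f\ge0,\ G(f)=0,\ \lim_{n}\sigma_{n+1}(f)/\sigma_n(f)=1\}$. For $f\in\mathcal F$, $\mathcal M_f=\{g\ge0: G(g)>0,\ fg\in L^1(\Lambda),\ \lim_{n}\sigma_n^2(fg)/\sigma_n^2(f)=G(g)\}$. $B$ = nonnegative Riemann integrable functions on $\Lambda$; $B_+^-=\{h\in B: m\le h\le M\text{ for some constants }0<m\le M\}$. Trigonometric polynomial: $t(\lambda)=\sum_{k=-\nu}^{\nu}c_ke^{ik\lambda}$.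 *)

theory Defs
  imports "HOL-Analysis.Analysis"
begin

definition Lam :: "real set" where
  "Lam = {-pi..pi}"

definition Lint :: "(real \<Rightarrow> real) \<Rightarrow> real" where
  "Lint f = integral\<^sup>L (lebesgue_on Lam) f"

definition L1 :: "(real \<Rightarrow> real) \<Rightarrow> bool" where
  "L1 f \<longleftrightarrow> integrable (lebesgue_on Lam) f"

text \<open>Geometric mean G(h). ln h in L^1 (with ln 0 = -infinity) means h > 0 a.e. and
  the (finite-valued) function ln h is integrable.\<close>
definition G :: "(real \<Rightarrow> real) \<Rightarrow> real" where
  "G h = (if (AE x in lebesgue_on Lam. h x > 0) \<and> L1 (\<lambda>x. ln (h x))
          then exp (1 / (2 * pi) * Lint (\<lambda>x. ln (h x))) else 0)"

text \<open>Prediction error sigma_n^2(f); only c 1, ..., c n matter.\<close>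
definition sigma2 :: "(real \<Rightarrow> real) \<Rightarrow> nat \<Rightarrow> real" where
  "sigma2 f n = (INF c \<in> (UNIV :: (nat \<Rightarrow> complex) set).
      Lint (\<lambda>x. (cmod (1 - (\<Sum>k = 1..n. c k * exp (- \<i> * of_nat k * of_real x))))\<^sup>2 * f x))"

definition sigma :: "(real \<Rightarrow> real) \<Rightarrow> nat \<Rightarrow> real" where
  "sigma f n = sqrt (sigma2 f n)"

definition classF :: "(real \<Rightarrow> real) \<Rightarrow> bool" where
  "classF f \<longleftrightarrow> L1 f \<and> (\<forall>x\<in>Lam. f x \<ge> 0) \<and> G f = 0 \<and>
     (\<lambda>n. sigma f (Suc n) / sigma f n) \<longlonglongrightarrow> 1"

definition classM :: "(real \<Rightarrow> real) \<Rightarrow> (real \<Rightarrow> real) \<Rightarrow> bool" where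
  "classM f g \<longleftrightarrow> (\<forall>x\<in>Lam. g x \<ge> 0) \<and> G g > 0 \<and> L1 (\<lambda>x. f x * g x) \<and>
     (\<lambda>n. sigma2 (\<lambda>x. f x * g x) n / sigma2 f n) \<longlonglongrightarrow> G g"

text \<open>Riemann integrability on a compact interval S (tagged divisions with mesh < delta).\<close>
definition riemann_integrable :: "(real \<Rightarrow> real) \<Rightarrow> real set \<Rightarrow> bool" where
  "riemann_integrable f S \<longleftrightarrow> (\<exists>I. \<forall>e>0. \<exists>d>0. \<forall>D.
      D tagged_division_of S \<and> (\<lambda>x. ball x d) fine D \<longrightarrow>
      \<bar>(\<Sum>(x, K)\<in>D. Henstock_Kurzweil_Integration.content K * f x) - I\<bar> < e)"

definition classB :: "(real \<Rightarrow> real) \<Rightarrow> bool" where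
  "classB h \<longleftrightarrow> (\<forall>x\<in>Lam. h x \<ge> 0) \<and> riemann_integrable h Lam"

definition classBpm :: "(real \<Rightarrow> real) \<Rightarrow> bool" where
  "classBpm h \<longleftrightarrow> classB h \<and> (\<exists>m M. 0 < m \<and> m \<le> M \<and> (\<forall>x\<in>Lam. m \<le> h x \<and> h x \<le> M))"

definition trig_poly :: "(real \<Rightarrow> complex) \<Rightarrow> bool" where
  "trig_poly t \<longleftrightarrow> (\<exists>(\<nu>::nat) (c::int \<Rightarrow> complex). \<forall>x.
      t x = (\<Sum>k \<in> {-int \<nu>..int \<nu>}. c k * exp (\<i> * of_int k * of_real x)))"

end

theory Submission
  imports Defs "HOL-Computational_Algebra.Fundamental_Theorem_Algebra"
begin

text \<open>
  With \<open>z = e\<^sup>-\<^sup>i\<^sup>x\<close>, the number \<open>\<sigma>\<^sub>n\<^sup>2(f)\<close> is the minimum of the integral of \<open>|q(z)|\<^sup>2 f\<close> over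
  polynomials \<open>q\<close> of degree at most \<open>n\<close> with \<open>q(0) = 1\<close>. Multiplying competitors by a fixed
  polynomial \<open>p\<close> with \<open>p(0) = 1\<close> turns a pointwise bound \<open>f |p|\<^sup>2 \<le> K w\<close> into
  \<open>\<sigma>\<^sup>2(f)\<close> at \<open>n + deg p\<close> being at most \<open>K \<sigma>\<^sup>2(w)\<close> at \<open>n\<close>, and for \<open>f\<close> in the class F the shift by
  \<open>deg p\<close> is asymptotically harmless. Truncating the exponential series of \<open>P/2\<close>, where \<open>P(0) = 0\<close>,
  gives such a \<open>p\<close> with \<open>|p|\<^sup>2\<close> close to \<open>exp (Re P)\<close>; so \<open>exp (Re P)\<close> multiplies prediction errors
  by its geometric mean, asymptotically. Sandwiching extends this to positive continuous functions
  (Stone--Weierstrass applied to the logarithm), then to Riemann integrable functions bounded away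
  from 0. Zeros are treated one linear factor \<open>p = 1 - b z\<close>, \<open>|b| \<le> 1\<close>, at a time: its geometric mean is 1, and for \<open>0 < \<beta> \<le> 2\<close>
  the function \<open>|p|\<^sup>\<beta>\<close> lies between \<open>|p|\<^sup>2 (|p| + \<epsilon>)\<^sup>\<beta>\<^sup>-\<^sup>2\<close> and \<open>(|p| + \<epsilon>)\<^sup>\<beta>\<close>. Products come for free, since
  multiplication by such a function maps F to itself.
\<close>

section \<open>Integration over \<open>Lam\<close>\<close>

abbreviation unit_circle :: "complex set" where
  "unit_circle \<equiv> sphere 0 1"

lemma Lam_lebesgue [simp]: "Lam \<in> sets lebesgue" "Lam \<inter> space lebesgue \<in> sets lebesgue"
  by (auto simp: Lam_def)

lemma Lint_const [simp]: "Lint (\<lambda>x. c) = 2 * pi * c"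
  by (simp add: Lint_def Lam_def measure_restrict_space)

lemma L1_continuous: "continuous_on Lam g \<Longrightarrow> L1 g"
  unfolding L1_def Lam_def
  using continuous_imp_integrable[of "-pi" pi g] by simp

lemma measurable_Lam_continuous:
  "continuous_on Lam (g :: real \<Rightarrow> real) \<Longrightarrow> g \<in> borel_measurable (lebesgue_on Lam)"
  by (rule continuous_imp_measurable_on_sets_lebesgue) auto

lemma L1_mult_bounded:
  assumes "L1 f" "g \<in> borel_measurable (lebesgue_on Lam)" "\<And>x. x \<in> Lam \<Longrightarrow> \<bar>g x\<bar> \<le> M"
  shows "L1 (\<lambda>x. f x * g x)"
  unfolding L1_def
proof (rule Bochner_Integration.integrable_bound[where f = "\<lambda>x. M * f x"])
  show "integrable (lebesgue_on Lam) (\<lambda>x. M * f x)"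
    using assms(1) by (simp add: L1_def)
  show "(\<lambda>x. f x * g x) \<in> borel_measurable (lebesgue_on Lam)"
    using assms(1,2) by (auto simp: L1_def dest: borel_measurable_integrable)
  have "norm (f x * g x) \<le> norm (M * f x)" if "x \<in> Lam" for x
    using assms(3)[OF that] mult_left_mono[of "\<bar>g x\<bar>" "\<bar>M\<bar>" "\<bar>f x\<bar>"]
    by (auto simp: abs_mult mult.commute)
  then show "AE x in lebesgue_on Lam. norm (f x * g x) \<le> norm (M * f x)"
    by (intro AE_I2) auto
qed

lemma L1_bounded:
  assumes "g \<in> borel_measurable (lebesgue_on Lam)" "\<And>x. x \<in> Lam \<Longrightarrow> \<bar>g x\<bar> \<le> M"
  shows "L1 g"
  using L1_mult_bounded[of "\<lambda>_. 1" g M] L1_continuous[of "\<lambda>_. 1"] assms by auto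

lemma Lint_mono:
  assumes "L1 f" "L1 g" "\<And>x. x \<in> Lam \<Longrightarrow> f x \<le> g x"
  shows "Lint f \<le> Lint g"
  using assms unfolding Lint_def L1_def by (intro integral_mono) auto

lemma Lint_cong:
  assumes "\<And>x. x \<in> Lam \<Longrightarrow> f x = g x"
  shows "Lint f = Lint g"
  using assms unfolding Lint_def by (intro Bochner_Integration.integral_cong) auto

lemma Lint_nonneg:
  assumes "\<And>x. x \<in> Lam \<Longrightarrow> 0 \<le> f x"
  shows "0 \<le> Lint f"
  using assms unfolding Lint_def by (intro integral_nonneg_AE AE_I2) auto

lemma L1_const [simp]: "L1 (\<lambda>x. c)"
  by (simp add: L1_continuous)

lemma L1_add: "L1 f \<Longrightarrow> L1 g \<Longrightarrow> L1 (\<lambda>x. f x + g x)"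
  and L1_diff: "L1 f \<Longrightarrow> L1 g \<Longrightarrow> L1 (\<lambda>x. f x - g x)"
  and L1_cmult: "L1 f \<Longrightarrow> L1 (\<lambda>x. c * f x)"
  by (simp_all add: L1_def)

lemma Lint_add: "L1 f \<Longrightarrow> L1 g \<Longrightarrow> Lint (\<lambda>x. f x + g x) = Lint f + Lint g"
  and Lint_diff: "L1 f \<Longrightarrow> L1 g \<Longrightarrow> Lint (\<lambda>x. f x - g x) = Lint f - Lint g"
  and Lint_cmult: "Lint (\<lambda>x. c * f x) = c * Lint f"
  by (simp_all add: L1_def Lint_def)

lemma continuous_Lam_bounded:
  fixes g :: "real \<Rightarrow> real"
  assumes "continuous_on Lam g"
  shows "\<exists>M. \<forall>x\<in>Lam. \<bar>g x\<bar> \<le> M"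
proof -
  have "bounded (g ` Lam)"
    by (intro compact_imp_bounded compact_continuous_image assms) (simp add: Lam_def)
  then show ?thesis by (auto simp: bounded_iff)
qed

text \<open>Non-integrable functions have Bochner integral 0 by default, so the integrals of
  competitors can be compared by monotonicity only once they are known to exist.\<close>

lemma L1_poly_weight:
  assumes "L1 f"
  shows "L1 (\<lambda>x. (cmod (poly q (cis (- x))))\<^sup>2 * f x)"
proof -
  let ?g = "\<lambda>x. (cmod (poly q (cis (- x))))\<^sup>2"
  have c: "continuous_on Lam ?g"
    by (intro continuous_intros)
  obtain M where "\<And>x. x \<in> Lam \<Longrightarrow> \<bar>?g x\<bar> \<le> M"
    using continuous_Lam_bounded[OF c] by blast
  then have "L1 (\<lambda>x. f x * ?g x)"
    by (intro L1_mult_bounded[OF assms] measurable_Lam_continuous c)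
  then show ?thesis by (simp add: mult.commute)
qed

section \<open>Prediction errors\<close>

text \<open>Written as polynomials in \<open>cis (- x)\<close>, competitors can be multiplied and
  their degrees added.\<close>

lemma sigma2_poly:
  "sigma2 f n = (INF q \<in> {q :: complex poly. degree q \<le> n \<and> coeff q 0 = 1}.
      Lint (\<lambda>x. (cmod (poly q (cis (- x))))\<^sup>2 * f x))"
proof -
  let ?L = "\<lambda>u. Lint (\<lambda>x. (cmod (u x))\<^sup>2 * f x)"
  let ?s = "\<lambda>(c :: nat \<Rightarrow> complex) x. 1 - (\<Sum>k = 1..n. c k * exp (- \<i> * of_nat k * of_real x))"
  let ?P = "{q :: complex poly. degree q \<le> n \<and> coeff q 0 = 1}"
  have ex: "exp (- \<i> * of_nat k * of_real x) = cis (- x) ^ k" for k :: nat and x :: real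
    by (simp add: cis_conv_exp exp_of_nat_mult[symmetric] algebra_simps)
  \<comment> \<open>The integral depends on a competitor only through its values, so it is enough
    that both families yield the same functions of \<open>x\<close>.\<close>
  have "range ?s = (\<lambda>q x. poly q (cis (- x))) ` ?P"
  proof (intro equalityI subsetI)
    fix u assume "u \<in> range ?s"
    then obtain c where u: "u = ?s c" by auto
    let ?q = "1 - (\<Sum>k = 1..n. monom (c k) k)"
    have "degree ?q \<le> n"
      by (intro degree_diff_le degree_sum_le) (auto intro: order.trans[OF degree_monom_le])
    moreover have "coeff ?q 0 = 1"
      by (simp add: coeff_sum)
    moreover have "u = (\<lambda>x. poly ?q (cis (- x)))"
      unfolding u ex by (simp add: poly_sum poly_monom)
    ultimately show "u \<in> (\<lambda>q x. poly q (cis (- x))) ` ?P" by blast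
  next
    fix u assume "u \<in> (\<lambda>q x. poly q (cis (- x))) ` ?P"
    then obtain q where q: "degree q \<le> n" "coeff q 0 = 1" "u = (\<lambda>x. poly q (cis (- x)))"
      by auto
    have "poly q z = 1 - (\<Sum>k = 1..n. - coeff q k * z ^ k)" for z
    proof -
      have "poly q z = poly (\<Sum>i\<le>n. monom (coeff q i) i) z"
        using poly_as_sum_of_monoms'[OF q(1)] by simp
      also have "\<dots> = (\<Sum>i\<le>n. coeff q i * z ^ i)"
        by (simp add: poly_sum poly_monom)
      also have "\<dots> = 1 + (\<Sum>k = 1..n. coeff q k * z ^ k)"
        unfolding atMost_atLeast0 using q(2) by (simp add: sum.atLeast_Suc_atMost)
      finally show ?thesis by (simp add: sum_negf)
    qed
    then have "u = ?s (\<lambda>k. - coeff q k)"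
      unfolding ex q(3) by (intro ext)
    then show "u \<in> range ?s" by (intro image_eqI[where x = "\<lambda>k. - coeff q k"]) auto
  qed
  then have "?L ` range ?s = ?L ` (\<lambda>q x. poly q (cis (- x))) ` ?P"
    by simp
  then show ?thesis
    unfolding sigma2_def by (simp add: image_image)
qed

lemma sigma2_nonneg:
  assumes "\<And>x. x \<in> Lam \<Longrightarrow> 0 \<le> f x"
  shows "0 \<le> sigma2 f n"
  unfolding sigma2_poly
proof (rule cINF_greatest)
  have "1 \<in> {q :: complex poly. degree q \<le> n \<and> coeff q 0 = 1}" by simp
  then show "{q :: complex poly. degree q \<le> n \<and> coeff q 0 = 1} \<noteq> {}" by blast
qed (auto intro!: Lint_nonneg mult_nonneg_nonneg assms)

lemma sigma2_le:
  assumes "\<And>x. x \<in> Lam \<Longrightarrow> 0 \<le> f x" "degree q \<le> n" "coeff q 0 = 1"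
  shows "sigma2 f n \<le> Lint (\<lambda>x. (cmod (poly q (cis (- x))))\<^sup>2 * f x)"
  unfolding sigma2_poly
  using assms by (intro cINF_lower bdd_belowI2[where m = 0] Lint_nonneg) auto

lemma sigma2_ge:
  assumes "\<And>q. degree q \<le> n \<Longrightarrow> coeff q 0 = 1 \<Longrightarrow> B \<le> Lint (\<lambda>x. (cmod (poly q (cis (- x))))\<^sup>2 * f x)"
  shows "B \<le> sigma2 f n"
  unfolding sigma2_poly
proof (rule cINF_greatest)
  have "1 \<in> {q :: complex poly. degree q \<le> n \<and> coeff q 0 = 1}" by simp
  then show "{q :: complex poly. degree q \<le> n \<and> coeff q 0 = 1} \<noteq> {}" by blast
qed (use assms in auto)

text \<open>If q competes for the weight w, then p q competes for f.\<close>
lemma sigma2_shift_le: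
  assumes f: "L1 f" "\<And>x. x \<in> Lam \<Longrightarrow> 0 \<le> f x"
    and w: "L1 w"
    and p: "coeff p 0 = 1" "degree p \<le> d"
    and K: "K > 0" "\<And>x. x \<in> Lam \<Longrightarrow> f x * (cmod (poly p (cis (- x))))\<^sup>2 \<le> K * w x"
  shows "sigma2 f (n + d) \<le> K * sigma2 w n"
proof -
  \<comment> \<open>Dividing by \<open>K\<close> leaves the infimum for \<open>w\<close> alone on
    the right, where it is bounded from below competitor by competitor.\<close>
  have "sigma2 f (n + d) / K \<le> sigma2 w n"
  proof (rule sigma2_ge)
    fix q :: "complex poly" assume q: "degree q \<le> n" "coeff q 0 = 1"
    let ?Q = "\<lambda>q x. (cmod (poly q (cis (- x))))\<^sup>2"
    have "degree (q * p) \<le> n + d"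
      using degree_mult_le[of q p] p q by linarith
    then have "sigma2 f (n + d) \<le> Lint (\<lambda>x. ?Q (q * p) x * f x)"
      using f p q by (intro sigma2_le) (auto simp: coeff_mult)
    also have "\<dots> \<le> Lint (\<lambda>x. K * (?Q q x * w x))"
    proof (rule Lint_mono)
      show "L1 (\<lambda>x. ?Q (q * p) x * f x)" by (rule L1_poly_weight[OF f(1)])
      show "L1 (\<lambda>x. K * (?Q q x * w x))"
        using L1_poly_weight[OF w, of q] by (simp add: L1_def)
      show "?Q (q * p) x * f x \<le> K * (?Q q x * w x)" if "x \<in> Lam" for x
        using mult_left_mono[OF K(2)[OF that], of "?Q q x"]
        by (simp add: norm_mult power_mult_distrib algebra_simps)
    qed
    also have "\<dots> = K * Lint (\<lambda>x. ?Q q x * w x)"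
      by (simp add: Lint_def)
    finally show "sigma2 f (n + d) / K \<le> Lint (\<lambda>x. ?Q q x * w x)"
      using K(1) by (simp add: field_simps)
  qed
  then show ?thesis using K(1) by (simp add: field_simps)
qed

lemma classF_D:
  assumes "classF f"
  shows "L1 f" "\<And>x. x \<in> Lam \<Longrightarrow> 0 \<le> f x" "G f = 0"
    "(\<lambda>n. sigma f (Suc n) / sigma f n) \<longlonglongrightarrow> 1"
  using assms by (auto simp: classF_def)

text \<open>Division by 0 yields 0, so a quotient with limit 1 forces nonzero denominators from some
  index on.\<close>

lemma classF_sigma2_pos:
  assumes "classF f"
  shows "eventually (\<lambda>n. sigma2 f n > 0) sequentially"
proof -
  have "eventually (\<lambda>n. sigma f (Suc n) / sigma f n > 0) sequentially"
    by (rule order_tendstoD(1)[OF classF_D(4)[OF assms]]) simp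
  then show ?thesis
  proof (rule eventually_mono)
    fix n assume "sigma f (Suc n) / sigma f n > 0"
    then have "sigma2 f n \<noteq> 0" by (auto simp: sigma_def)
    then show "sigma2 f n > 0"
      using sigma2_nonneg[of f n] classF_D(2)[OF assms] by fastforce
  qed
qed

text \<open>Squaring the limit in the definition of the class gives the shift by 1; longer shifts
  telescope. This is why a factor of fixed degree costs nothing in the limit.\<close>

lemma classF_sigma2_ratio:
  assumes "classF f"
  shows "(\<lambda>n. sigma2 f (n + d) / sigma2 f n) \<longlonglongrightarrow> 1"
proof (induction d)
  case 0
  have "eventually (\<lambda>n. sigma2 f (n + 0) / sigma2 f n = 1) sequentially"
    using classF_sigma2_pos[OF assms] by eventually_elim simp
  then show ?case by (rule tendsto_eventually)
next
  case (Suc d)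
  have nn: "sigma2 f n \<ge> 0" for n
    by (rule sigma2_nonneg) (rule classF_D(2)[OF assms])
  have "(\<lambda>n. (sigma f (Suc n) / sigma f n)\<^sup>2) \<longlonglongrightarrow> 1"
    using tendsto_power[OF classF_D(4)[OF assms], of 2] by simp
  then have "(\<lambda>n. sigma2 f (Suc n) / sigma2 f n) \<longlonglongrightarrow> 1"
    using nn by (simp add: sigma_def power_divide)
  from LIMSEQ_ignore_initial_segment[OF this, of d]
  have "(\<lambda>n. sigma2 f (Suc (n + d)) / sigma2 f (n + d) * (sigma2 f (n + d) / sigma2 f n)) \<longlonglongrightarrow> 1 * 1"
    by (intro tendsto_mult Suc.IH)
  moreover have "eventually (\<lambda>n. sigma2 f (Suc (n + d)) / sigma2 f (n + d) * (sigma2 f (n + d) / sigma2 f n)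
      = sigma2 f (n + Suc d) / sigma2 f n) sequentially"
    using eventually_sequentially_seg[where k = d, THEN iffD2, OF classF_sigma2_pos[OF assms]]
    by eventually_elim simp
  ultimately show ?case by (auto elim: Lim_transform_eventually)
qed

text \<open>By \<open>sigma2_shift_le\<close>, \<open>sigma2 f\<close> at
  \<open>n + degree p\<close> is at most \<open>K\<close> times \<open>sigma2 w\<close> at
  \<open>n\<close>, and shifting the index of \<open>sigma2 f\<close> is harmless in the
  limit.\<close>

lemma sigma2_ratio_lower:
  assumes f: "classF f" and w: "L1 w"
    and p: "coeff p 0 = 1"
    and K: "K > 0" "\<And>x. x \<in> Lam \<Longrightarrow> f x * (cmod (poly p (cis (- x))))\<^sup>2 \<le> K * w x"
    and a: "a < 1 / K"
  shows "eventually (\<lambda>n. a < sigma2 w n / sigma2 f n) sequentially"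
proof -
  have "a * K < 1" using a K(1) by (simp add: field_simps)
  then have "eventually (\<lambda>n. a * K < sigma2 f (n + degree p) / sigma2 f n) sequentially"
    by (rule order_tendstoD(1)[OF classF_sigma2_ratio[OF f]])
  then show ?thesis using classF_sigma2_pos[OF f]
  proof eventually_elim
    case (elim n)
    have "sigma2 f (n + degree p) \<le> K * sigma2 w n"
      by (rule sigma2_shift_le[OF classF_D(1,2)[OF f] w p _ K]) auto
    with elim have "a * K * sigma2 f n < K * sigma2 w n"
      by (simp add: field_simps)
    then have "a * sigma2 f n < sigma2 w n"
      using K(1) by (simp add: mult.commute mult.left_commute)
    then show ?case using elim by (simp add: field_simps)
  qed
qed

text \<open>Here \<open>f\<close> and \<open>w\<close> exchange roles. The shift falls on
  \<open>w\<close>, so the estimate is first obtained at index \<open>n + degree p\<close> and then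
  reindexed.\<close>

lemma sigma2_ratio_upper:
  assumes f: "classF f" and w: "L1 w" "\<And>x. x \<in> Lam \<Longrightarrow> 0 \<le> w x"
    and p: "coeff p 0 = 1"
    and K: "K > 0" "\<And>x. x \<in> Lam \<Longrightarrow> w x * (cmod (poly p (cis (- x))))\<^sup>2 \<le> K * f x"
    and a: "K < a"
  shows "eventually (\<lambda>n. sigma2 w n / sigma2 f n < a) sequentially"
proof -
  let ?d = "degree p"
  have "K / a < 1" using a K(1) by (simp add: field_simps)
  then have "eventually (\<lambda>n. K / a < sigma2 f (n + ?d) / sigma2 f n) sequentially"
    by (rule order_tendstoD(1)[OF classF_sigma2_ratio[OF f]])
  then have "eventually (\<lambda>n. sigma2 w (n + ?d) / sigma2 f (n + ?d) < a) sequentially"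
    using classF_sigma2_pos[OF f]
      eventually_sequentially_seg[where k = ?d, THEN iffD2, OF classF_sigma2_pos[OF f]]
  proof eventually_elim
    case (elim n)
    have "sigma2 w (n + ?d) \<le> K * sigma2 f n"
      by (rule sigma2_shift_le[OF w classF_D(1)[OF f] p _ K]) auto
    also have "\<dots> < a * sigma2 f (n + ?d)"
      using elim a K(1) by (simp add: field_simps)
    finally show ?case using elim by (simp add: field_simps)
  qed
  then show ?thesis by (rule eventually_sequentially_seg[THEN iffD1])
qed

section \<open>Multipliers\<close>

text \<open>Measurability and boundedness keep \<open>f * g\<close> integrable; the last two
  conditions put \<open>G g\<close> into its exponential branch, so that it is positive.\<close>

definition admissible :: "(real \<Rightarrow> real) \<Rightarrow> bool" where
  "admissible g \<longleftrightarrow> g \<in> borel_measurable (lebesgue_on Lam) \<and>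
     (\<exists>M. \<forall>x\<in>Lam. 0 \<le> g x \<and> g x \<le> M) \<and>
     (AE x in lebesgue_on Lam. g x > 0) \<and> L1 (\<lambda>x. ln (g x))"

text \<open>The limit is demanded for every \<open>f\<close> in the class, so that a second
  multiplier can be applied to the weight already changed by the first.\<close>

definition multiplier :: "(real \<Rightarrow> real) \<Rightarrow> bool" where
  "multiplier g \<longleftrightarrow> admissible g \<and>
     (\<forall>f. classF f \<longrightarrow> (\<lambda>n. sigma2 (\<lambda>x. f x * g x) n / sigma2 f n) \<longlonglongrightarrow> G g)"

lemma admissibleD:
  assumes "admissible g"
  shows "g \<in> borel_measurable (lebesgue_on Lam)" "\<And>x. x \<in> Lam \<Longrightarrow> 0 \<le> g x"
    "\<exists>M. \<forall>x\<in>Lam. \<bar>g x\<bar> \<le> M" "AE x in lebesgue_on Lam. g x > 0" "L1 (\<lambda>x. ln (g x))"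
    "G g = exp (1 / (2 * pi) * Lint (\<lambda>x. ln (g x)))"
proof -
  obtain M where "\<forall>x\<in>Lam. 0 \<le> g x \<and> g x \<le> M"
    using assms by (auto simp: admissible_def)
  then show "\<exists>M. \<forall>x\<in>Lam. \<bar>g x\<bar> \<le> M" by (intro exI[of _ M]) auto
qed (use assms in \<open>auto simp: admissible_def G_def\<close>)

lemma L1_mult_admissible:
  assumes "L1 f" "admissible g"
  shows "L1 (\<lambda>x. f x * g x)"
  using L1_mult_bounded[OF assms(1)] admissibleD(1,3)[OF assms(2)] by blast

text \<open>Subtracting the integrable \<open>ln (g x)\<close> from an integrable
  \<open>ln (f x * g x)\<close> would make \<open>ln (f x)\<close> integrable and \<open>G f\<close>
  positive.\<close>

lemma G_mult_zero:
  assumes "L1 f" "G f = 0" "admissible g"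
  shows "G (\<lambda>x. f x * g x) = 0"
proof (rule ccontr)
  assume "G (\<lambda>x. f x * g x) \<noteq> 0"
  then have ae: "AE x in lebesgue_on Lam. f x * g x > 0" and l: "L1 (\<lambda>x. ln (f x * g x))"
    by (auto simp: G_def split: if_splits)
  note g = admissibleD[OF assms(3)]
  have pos: "AE x in lebesgue_on Lam. f x > 0"
    using ae g(4) by eventually_elim (auto simp: zero_less_mult_iff)
  have diff: "L1 (\<lambda>x. ln (f x * g x) - ln (g x))"
    using l g(5) by (simp add: L1_def)
  have "AE x in lebesgue_on Lam. ln (f x * g x) - ln (g x) = ln (f x)"
    using pos g(4) by eventually_elim (simp add: ln_mult)
  moreover have "(\<lambda>x. ln (f x)) \<in> borel_measurable (lebesgue_on Lam)"
    using borel_measurable_integrable assms(1) unfolding L1_def by simp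
  ultimately have "L1 (\<lambda>x. ln (f x))"
    using integrable_cong_AE_imp diff unfolding L1_def by blast
  with pos have "G f > 0" by (simp add: G_def)
  with assms(2) show False by simp
qed

text \<open>The errors of \<open>f * g\<close> divided by those of \<open>f\<close> tend to a
  positive limit, so consecutive errors of \<open>f * g\<close> have asymptotically the same ratio
  as those of \<open>f\<close>.\<close>

lemma multiplier_classF:
  assumes "multiplier g" "classF f"
  shows "classF (\<lambda>x. f x * g x)"
  unfolding classF_def
proof (intro conjI ballI)
  have adm: "admissible g" and lim: "(\<lambda>n. sigma2 (\<lambda>x. f x * g x) n / sigma2 f n) \<longlonglongrightarrow> G g"
    using assms by (auto simp: multiplier_def)
  note f = classF_D[OF assms(2)] and g = admissibleD[OF adm]
  let ?s = "sigma2 (\<lambda>x. f x * g x)"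
  show "L1 (\<lambda>x. f x * g x)" by (rule L1_mult_admissible[OF f(1) adm])
  show nn: "f x * g x \<ge> 0" if "x \<in> Lam" for x using f(2) g(2) that by simp
  show "G (\<lambda>x. f x * g x) = 0" by (rule G_mult_zero[OF f(1,3) adm])
  have G: "G g > 0" using g(6) by simp
  have "(\<lambda>n. (?s (n + 1) / sigma2 f (n + 1)) / (?s n / sigma2 f n) * (sigma2 f (n + 1) / sigma2 f n))
      \<longlonglongrightarrow> G g / G g * 1"
    using G by (intro tendsto_mult tendsto_divide lim classF_sigma2_ratio[OF assms(2)]
      LIMSEQ_ignore_initial_segment[OF lim]) auto
  then have "(\<lambda>n. (?s (n + 1) / sigma2 f (n + 1)) / (?s n / sigma2 f n) * (sigma2 f (n + 1) / sigma2 f n))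
      \<longlonglongrightarrow> 1"
    using G by simp
  moreover have "eventually (\<lambda>n. (?s (n + 1) / sigma2 f (n + 1)) / (?s n / sigma2 f n)
      * (sigma2 f (n + 1) / sigma2 f n) = ?s (Suc n) / ?s n) sequentially"
    using classF_sigma2_pos[OF assms(2)]
      eventually_sequentially_seg[where k = 1, THEN iffD2, OF classF_sigma2_pos[OF assms(2)]]
    by eventually_elim simp
  ultimately have "(\<lambda>n. ?s (Suc n) / ?s n) \<longlonglongrightarrow> 1"
    by (rule Lim_transform_eventually)
  from tendsto_real_sqrt[OF this]
  show "(\<lambda>n. sigma (\<lambda>x. f x * g x) (Suc n) / sigma (\<lambda>x. f x * g x) n) \<longlonglongrightarrow> 1"
    by (simp add: sigma_def real_sqrt_divide)
qed

lemma multiplier_classM: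
  assumes "multiplier g" "classF f"
  shows "classM f g"
proof -
  have adm: "admissible g" and lim: "(\<lambda>n. sigma2 (\<lambda>x. f x * g x) n / sigma2 f n) \<longlonglongrightarrow> G g"
    using assms by (auto simp: multiplier_def)
  then show ?thesis
    using admissibleD[OF adm] L1_mult_admissible[OF classF_D(1)[OF assms(2)] adm]
    by (simp add: classM_def)
qed

text \<open>The logarithm is additive off the zeros of the two factors, which form a null set;
  integrability and the integral pass through almost everywhere equality.\<close>

lemma admissible_mult:
  assumes "admissible g" "admissible h"
  shows "admissible (\<lambda>x. g x * h x)" "G (\<lambda>x. g x * h x) = G g * G h"
proof -
  note g = admissibleD[OF assms(1)] and h = admissibleD[OF assms(2)]
  obtain M N where MN: "\<And>x. x \<in> Lam \<Longrightarrow> \<bar>g x\<bar> \<le> M" "\<And>x. x \<in> Lam \<Longrightarrow> \<bar>h x\<bar> \<le> N"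
    using g(3) h(3) by blast
  have meas: "(\<lambda>x. g x * h x) \<in> borel_measurable (lebesgue_on Lam)"
    using g(1) h(1) by simp
  have "0 \<le> g x * h x \<and> g x * h x \<le> M * N" if "x \<in> Lam" for x
    using MN[OF that] g(2)[OF that] h(2)[OF that] by (auto intro!: mult_mono)
  then have bdd: "\<exists>M. \<forall>x\<in>Lam. 0 \<le> g x * h x \<and> g x * h x \<le> M" by blast
  have pos: "AE x in lebesgue_on Lam. g x * h x > 0"
    using g(4) h(4) by eventually_elim simp
  have eq: "AE x in lebesgue_on Lam. ln (g x) + ln (h x) = ln (g x * h x)"
    using g(4) h(4) by eventually_elim (simp add: ln_mult)
  have int: "integrable (lebesgue_on Lam) (\<lambda>x. ln (g x) + ln (h x))"
    using g(5) h(5) by (simp add: L1_def)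
  have "L1 (\<lambda>x. ln (g x * h x))"
    unfolding L1_def by (rule integrable_cong_AE_imp[OF int _ eq]) (use meas in measurable)
  then show adm: "admissible (\<lambda>x. g x * h x)"
    using meas bdd pos by (simp add: admissible_def)
  have "Lint (\<lambda>x. ln (g x * h x)) = Lint (\<lambda>x. ln (g x) + ln (h x))"
    unfolding Lint_def
    by (rule integral_cong_AE) (use eq meas g(1) h(1) in auto)
  also have "\<dots> = Lint (\<lambda>x. ln (g x)) + Lint (\<lambda>x. ln (h x))"
    using g(5) h(5) by (simp add: L1_def Lint_def)
  finally show "G (\<lambda>x. g x * h x) = G g * G h"
    unfolding admissibleD(6)[OF adm] g(6) h(6) by (simp add: distrib_left exp_add)
qed

text \<open>The property of \<open>h\<close> is applied to the weight \<open>f * g\<close>, which is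
  in the class by \<open>multiplier_classF\<close>; the two quotients then telescope.\<close>

lemma multiplier_mult:
  assumes "multiplier g" "multiplier h"
  shows "multiplier (\<lambda>x. g x * h x)"
proof -
  have adm: "admissible g" "admissible h" using assms by (auto simp: multiplier_def)
  have "(\<lambda>n. sigma2 (\<lambda>x. f x * (g x * h x)) n / sigma2 f n) \<longlonglongrightarrow> G (\<lambda>x. g x * h x)"
    if f: "classF f" for f
  proof -
    have fg: "classF (\<lambda>x. f x * g x)" by (rule multiplier_classF[OF assms(1) f])
    have "(\<lambda>n. sigma2 (\<lambda>x. f x * g x * h x) n / sigma2 (\<lambda>x. f x * g x) n
        * (sigma2 (\<lambda>x. f x * g x) n / sigma2 f n)) \<longlonglongrightarrow> G h * G g"
      using assms f fg by (intro tendsto_mult) (auto simp: multiplier_def)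
    moreover have "eventually (\<lambda>n. sigma2 (\<lambda>x. f x * g x * h x) n / sigma2 (\<lambda>x. f x * g x) n
        * (sigma2 (\<lambda>x. f x * g x) n / sigma2 f n)
        = sigma2 (\<lambda>x. f x * (g x * h x)) n / sigma2 f n) sequentially"
      using classF_sigma2_pos[OF fg] by eventually_elim (simp add: mult.assoc)
    ultimately show ?thesis
      unfolding admissible_mult(2)[OF adm] mult.commute[of "G g"]
      by (rule Lim_transform_eventually)
  qed
  then show ?thesis using admissible_mult(1)[OF adm] by (simp add: multiplier_def)
qed

lemma admissible_continuous:
  assumes "continuous_on Lam g" "\<And>x. x \<in> Lam \<Longrightarrow> 0 < g x"
  shows "admissible g"
proof -
  have "continuous_on Lam (\<lambda>x. ln (g x))"
    using assms by (intro continuous_intros) force+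
  then have "L1 (\<lambda>x. ln (g x))" by (rule L1_continuous)
  moreover have "AE x in lebesgue_on Lam. g x > 0"
    using assms by (intro AE_I2) auto
  moreover obtain M where "\<forall>x\<in>Lam. \<bar>g x\<bar> \<le> M"
    using continuous_Lam_bounded[OF assms(1)] by blast
  then have "\<exists>M. \<forall>x\<in>Lam. 0 \<le> g x \<and> g x \<le> M"
    using assms(2) by (intro exI[of _ M]) (force simp: less_imp_le)
  ultimately show ?thesis
    using measurable_Lam_continuous[OF assms(1)] by (simp add: admissible_def)
qed

lemma sigma2_mono:
  assumes "L1 f" "L1 w" "\<And>x. x \<in> Lam \<Longrightarrow> 0 \<le> f x" "\<And>x. x \<in> Lam \<Longrightarrow> f x \<le> w x"
  shows "sigma2 f n \<le> sigma2 w n"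
  using sigma2_shift_le[of f w 1 0 1 n] assms by simp

text \<open>Prediction errors are monotone in the weight, so multipliers on both sides of
  \<open>g\<close> with geometric means arbitrarily close to \<open>G g\<close> squeeze the
  quotients.\<close>

lemma multiplier_sandwich:
  assumes g: "admissible g"
    and lo: "\<And>a. a < G g \<Longrightarrow> \<exists>\<phi>. multiplier \<phi> \<and> (\<forall>x\<in>Lam. \<phi> x \<le> g x) \<and> a < G \<phi>"
    and up: "\<And>a. G g < a \<Longrightarrow> \<exists>\<phi>. multiplier \<phi> \<and> (\<forall>x\<in>Lam. g x \<le> \<phi> x) \<and> G \<phi> < a"
  shows "multiplier g"
  unfolding multiplier_def
proof (intro conjI allI impI g)
  fix f assume f: "classF f"
  note F = classF_D[OF f]
  show "(\<lambda>n. sigma2 (\<lambda>x. f x * g x) n / sigma2 f n) \<longlonglongrightarrow> G g"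
  proof (rule order_tendstoI)
    fix a assume "a < G g"
    then obtain \<phi> where m: "multiplier \<phi>" and le: "\<forall>x\<in>Lam. \<phi> x \<le> g x" and a: "a < G \<phi>"
      using lo by blast
    have adm: "admissible \<phi>" and "(\<lambda>n. sigma2 (\<lambda>x. f x * \<phi> x) n / sigma2 f n) \<longlonglongrightarrow> G \<phi>"
      using m f by (auto simp: multiplier_def)
    then have "eventually (\<lambda>n. a < sigma2 (\<lambda>x. f x * \<phi> x) n / sigma2 f n) sequentially"
      using a by (auto dest: order_tendstoD(1))
    then show "eventually (\<lambda>n. a < sigma2 (\<lambda>x. f x * g x) n / sigma2 f n) sequentially"
      using classF_sigma2_pos[OF f]
    proof eventually_elim
      case (elim n)
      have "sigma2 (\<lambda>x. f x * \<phi> x) n \<le> sigma2 (\<lambda>x. f x * g x) n"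
        using le F(2) admissibleD(2)[OF adm]
        by (intro sigma2_mono L1_mult_admissible F(1) adm g) (auto intro: mult_left_mono)
      with elim show ?case by (smt (verit) divide_right_mono)
    qed
  next
    fix a assume "G g < a"
    then obtain \<phi> where m: "multiplier \<phi>" and le: "\<forall>x\<in>Lam. g x \<le> \<phi> x" and a: "G \<phi> < a"
      using up by blast
    have adm: "admissible \<phi>" and "(\<lambda>n. sigma2 (\<lambda>x. f x * \<phi> x) n / sigma2 f n) \<longlonglongrightarrow> G \<phi>"
      using m f by (auto simp: multiplier_def)
    then have "eventually (\<lambda>n. sigma2 (\<lambda>x. f x * \<phi> x) n / sigma2 f n < a) sequentially"
      using a by (auto dest: order_tendstoD(2))
    then show "eventually (\<lambda>n. sigma2 (\<lambda>x. f x * g x) n / sigma2 f n < a) sequentially"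
      using classF_sigma2_pos[OF f]
    proof eventually_elim
      case (elim n)
      have "sigma2 (\<lambda>x. f x * g x) n \<le> sigma2 (\<lambda>x. f x * \<phi> x) n"
        using le F(2) admissibleD(2)[OF g]
        by (intro sigma2_mono L1_mult_admissible F(1) adm g) (auto intro: mult_left_mono)
      with elim show ?case by (smt (verit) divide_right_mono)
    qed
  qed
qed

section \<open>Continuous multipliers\<close>

lemma Lint_Re_cis:
  assumes "k > 0"
  shows "Lint (\<lambda>x. Re (c * cis (- x) ^ k)) = 0"
proof -
  let ?F = "\<lambda>x::real. (Re c * sin (k * x) - Im c * cos (k * x)) / k"
  let ?f = "\<lambda>x. Re (c * cis (- x) ^ k)"
  have eq: "Re c * cos (k * x) + Im c * sin (k * x) = ?f x" for x :: real
    by (simp add: Complex.DeMoivre)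
  have "((\<lambda>x. Re c * cos (k * x) + Im c * sin (k * x)) has_integral (?F pi - ?F (- pi))) {- pi..pi}"
    by (rule fundamental_theorem_of_calculus)
       (use assms in \<open>auto simp: has_real_derivative_iff_has_vector_derivative[symmetric]
          intro!: derivative_eq_intros, auto simp: field_simps\<close>)
  then have "((\<lambda>x. Re c * cos (k * x) + Im c * sin (k * x)) has_integral 0) Lam"
    by (simp add: Lam_def)
  from has_integral_eq[OF eq this] have "(?f has_integral 0) Lam" .
  moreover have "L1 ?f"
    by (intro L1_continuous continuous_intros)
  ultimately show ?thesis
    unfolding Lint_def L1_def
    by (simp add: lebesgue_integral_eq_integral integral_unique)
qed

text \<open>This is the mean value property at the origin: monomials of positive degree integrate to
  0.\<close>

lemma Lint_Re_poly: "Lint (\<lambda>x. Re (poly P (cis (- x)))) = 2 * pi * Re (coeff P 0)"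
proof -
  have "Lint (\<lambda>x. Re (poly P (cis (- x)))) = Lint (\<lambda>x. \<Sum>k\<le>degree P. Re (coeff P k * cis (- x) ^ k))"
    by (simp add: poly_altdef)
  also have "\<dots> = (\<Sum>k\<le>degree P. Lint (\<lambda>x. Re (coeff P k * cis (- x) ^ k)))"
    unfolding Lint_def
    by (rule Bochner_Integration.integral_sum)
       (fold L1_def, intro L1_continuous continuous_intros)
  also have "\<dots> = (\<Sum>k\<le>degree P. if k = 0 then 2 * pi * Re (coeff P 0) else 0)"
    by (rule sum.cong) (auto simp: Lint_Re_cis simp del: times_complex.sel)
  finally show ?thesis by (simp add: sum.delta)
qed

text \<open>The polynomial is a Taylor section of \<open>exp\<close> at \<open>P / 2\<close>; the
  half is there because \<open>exp (P / 2)\<close> has squared modulus \<open>exp (Re P)\<close>. A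
  zero constant term of \<open>P\<close> makes that of \<open>p\<close> equal to 1.\<close>

lemma exp_approx_poly:
  assumes "coeff P 0 = 0" "\<epsilon> > 0"
  shows "\<exists>p. coeff p 0 = 1 \<and>
    (\<forall>x. (cmod (poly p (cis (- x))))\<^sup>2 \<le> (1 + \<epsilon>) * exp (Re (poly P (cis (- x)))))"
proof -
  have "compact ((\<lambda>z. poly P z / 2) ` unit_circle)"
    by (intro compact_continuous_image continuous_intros) auto
  then have "bounded ((\<lambda>z. poly P z / 2) ` unit_circle)"
    by (rule compact_imp_bounded)
  then obtain B where B: "\<And>z. cmod z = 1 \<Longrightarrow> cmod (poly P z / 2) \<le> B"
    unfolding bounded_iff by (metis (no_types, lifting) dist_0_norm imageI mem_sphere)
  \<comment> \<open>A relative error \<eta> in the modulus becomes \<epsilon> after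
    squaring.\<close>
  define \<eta> where "\<eta> = sqrt (1 + \<epsilon>) - 1"
  have \<eta>: "\<eta> > 0" "(1 + \<eta>)\<^sup>2 = 1 + \<epsilon>"
    using assms by (auto simp: \<eta>_def)
  \<comment> \<open>The left side bounds the Taylor remainder. It is compared with
    \<open>exp (- B)\<close>, a lower bound of \<open>exp (Re (poly P z / 2))\<close> on the circle,
    to make the error relative.\<close>
  have "(\<lambda>n. exp B * (B * (B ^ n / fact n))) \<longlonglongrightarrow> exp B * (B * 0)"
    using summable_LIMSEQ_zero[OF summable_exp[of B]] by (intro tendsto_intros) (simp add: field_simps)
  then have "eventually (\<lambda>n. exp B * (B * (B ^ n / fact n)) < \<eta> * exp (- B)) sequentially"
    by (rule order_tendstoD) (use \<eta> in simp)
  then obtain N where N: "exp B * (B * (B ^ N / fact N)) < \<eta> * exp (- B)"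
    by (auto simp: eventually_sequentially)
  define p where "p = (\<Sum>k\<le>N. smult (1 / (fact k * 2 ^ k)) (P ^ k))"
  have p: "poly p z = (\<Sum>k\<le>N. (poly P z / 2) ^ k / fact k)" for z
    by (simp add: p_def poly_sum power_divide field_simps)
  have "coeff p 0 = poly p 0" by (simp add: poly_0_coeff_0)
  also have "\<dots> = (\<Sum>k\<le>N. if k = 0 then 1 else 0)"
    unfolding p using assms(1) by (intro sum.cong) (auto simp: poly_0_coeff_0)
  finally have "coeff p 0 = 1" by simp
  moreover have "(cmod (poly p z))\<^sup>2 \<le> (1 + \<epsilon>) * exp (Re (poly P z))" if z: "cmod z = 1" for z
  proof -
    let ?w = "poly P z / 2"
    have w: "cmod ?w \<le> B" by (rule B[OF z])
    have B0: "B \<ge> 0" using w norm_ge_zero order_trans by blast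
    have "cmod (exp ?w - poly p z) \<le> exp (cmod ?w) * cmod ?w ^ Suc N / fact N"
      unfolding p by (rule Taylor_exp_field)
    also have "\<dots> \<le> exp B * B ^ Suc N / fact N"
      using w B0 by (intro divide_right_mono mult_mono power_mono) auto
    also have "\<dots> \<le> \<eta> * exp (- B)" using N by simp
    also have "\<dots> \<le> \<eta> * exp (Re ?w)"
      using w abs_Re_le_cmod[of ?w] \<eta>(1) by (intro mult_left_mono) auto
    finally have "cmod (poly p z) \<le> cmod (exp ?w) + \<eta> * exp (Re ?w)"
      using norm_triangle_ineq2[of "poly p z" "exp ?w"] by (simp add: norm_minus_commute)
    then have "cmod (poly p z) \<le> (1 + \<eta>) * exp (Re ?w)"
      by (simp add: algebra_simps)
    then have "(cmod (poly p z))\<^sup>2 \<le> ((1 + \<eta>) * exp (Re ?w))\<^sup>2"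
      by (intro power_mono) auto
    also have "\<dots> = (1 + \<epsilon>) * exp (Re (poly P z))"
      by (simp add: power_mult_distrib \<eta>(2) exp_double[symmetric])
    finally show ?thesis .
  qed
  ultimately show ?thesis by (intro exI[of _ p]) auto
qed

lemma admissible_exp_poly:
  "admissible (\<lambda>x. exp (Re (poly P (cis (- x)))))"
  by (intro admissible_continuous continuous_intros) auto

lemma G_exp_poly: "G (\<lambda>x. exp (Re (poly P (cis (- x))))) = exp (Re (coeff P 0))"
  unfolding admissibleD(6)[OF admissible_exp_poly] by (simp add: Lint_Re_poly)

text \<open>Approximating the exponential of \<open>P / 2\<close> makes \<open>f\<close> times the
  squared modulus of \<open>p\<close> nearly comparable to \<open>?w\<close>, which gives the lower
  limit. Using \<open>- P\<close> instead cancels the exponential in \<open>?w\<close> and gives the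
  upper limit.\<close>

lemma multiplier_exp_poly: "multiplier (\<lambda>x. exp (Re (poly P (cis (- x)))))"
  unfolding multiplier_def
proof (intro conjI allI impI admissible_exp_poly)
  fix f assume f: "classF f"
  note F = classF_D[OF f]
  let ?c = "Re (coeff P 0)" and ?e = "\<lambda>x. exp (Re (poly P (cis (- x))))"
  let ?w = "\<lambda>x. f x * ?e x"
  have w: "L1 ?w" "\<And>x. x \<in> Lam \<Longrightarrow> 0 \<le> ?w x"
    using F(2) by (auto intro: L1_mult_admissible[OF F(1) admissible_exp_poly])
  \<comment> \<open>Removing the constant coefficient secures \<open>coeff p 0 = 1\<close>; its real
    part returns below as the factor \<open>exp ?c\<close>, the geometric mean.\<close>
  have approx: "\<exists>p. coeff p 0 = 1 \<and>
    (\<forall>x. (cmod (poly p (cis (- x))))\<^sup>2 \<le> (1 + \<epsilon>) * exp (Re (poly Q (cis (- x))) - Re (coeff Q 0)))"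
    if "\<epsilon> > 0" for \<epsilon> and Q :: "complex poly"
    using exp_approx_poly[of "Q - [:coeff Q 0:]" \<epsilon>] that by simp
  show "(\<lambda>n. sigma2 ?w n / sigma2 f n) \<longlonglongrightarrow> G ?e"
    unfolding G_exp_poly
  proof (rule order_tendstoI)
    fix a assume a: "a < exp ?c"
    have "((\<lambda>\<epsilon>. exp ?c / (1 + \<epsilon>)) \<longlongrightarrow> exp ?c / (1 + 0)) (at_right 0)"
      by (intro tendsto_intros) auto
    then have "eventually (\<lambda>\<epsilon>. a < exp ?c / (1 + \<epsilon>)) (at_right 0)"
      using a by (intro order_tendstoD(1)[of _ "exp ?c"]) simp_all
    moreover have "eventually (\<lambda>\<epsilon>::real. \<epsilon> > 0) (at_right 0)"
      by (rule eventually_at_right_less)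
    ultimately have "eventually (\<lambda>\<epsilon>. a < exp ?c / (1 + \<epsilon>) \<and> \<epsilon> > 0) (at_right 0)"
      by eventually_elim simp
    then obtain \<epsilon> where \<epsilon>: "\<epsilon> > 0" "a < exp ?c / (1 + \<epsilon>)"
      using eventually_happens'[OF trivial_limit_at_right_real] by blast
    obtain p where p: "coeff p 0 = 1"
      "\<And>x. (cmod (poly p (cis (- x))))\<^sup>2 \<le> (1 + \<epsilon>) * exp (Re (poly P (cis (- x))) - ?c)"
      using approx[OF \<epsilon>(1), of P] by blast
    show "eventually (\<lambda>n. a < sigma2 ?w n / sigma2 f n) sequentially"
    proof (rule sigma2_ratio_lower[OF f w(1) p(1), of "(1 + \<epsilon>) / exp ?c"])
      show "f x * (cmod (poly p (cis (- x))))\<^sup>2 \<le> (1 + \<epsilon>) / exp ?c * ?w x" if "x \<in> Lam" for x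
        using mult_left_mono[OF p(2)[of x] F(2)[OF that]] by (simp add: exp_diff field_simps)
    qed (use \<epsilon> in auto)
  next
    fix a assume a: "exp ?c < a"
    \<comment> \<open>With this choice \<open>(1 + \<epsilon>) * exp ?c\<close> is the midpoint of
      \<open>exp ?c\<close> and \<open>a\<close>.\<close>
    define \<epsilon> where "\<epsilon> = (a / exp ?c - 1) / 2"
    have \<epsilon>: "\<epsilon> > 0" using a by (simp add: \<epsilon>_def)
    have "(1 + \<epsilon>) * exp ?c < a" using a by (simp add: \<epsilon>_def field_simps)
    obtain p where p: "coeff p 0 = 1"
      "\<And>x. (cmod (poly p (cis (- x))))\<^sup>2 \<le> (1 + \<epsilon>) * exp (?c - Re (poly P (cis (- x))))"
      using approx[OF \<epsilon>(1), of "- P"] by auto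
    show "eventually (\<lambda>n. sigma2 ?w n / sigma2 f n < a) sequentially"
    proof (rule sigma2_ratio_upper[OF f w p(1), of "(1 + \<epsilon>) * exp ?c"])
      show "?w x * (cmod (poly p (cis (- x))))\<^sup>2 \<le> (1 + \<epsilon>) * exp ?c * f x" if "x \<in> Lam" for x
      proof -
        have "?w x * (cmod (poly p (cis (- x))))\<^sup>2
            \<le> ?w x * ((1 + \<epsilon>) * exp (?c - Re (poly P (cis (- x)))))"
          by (rule mult_left_mono[OF p(2) w(2)[OF that]])
        also have "\<dots> = (1 + \<epsilon>) * exp ?c * f x"
          by (simp add: exp_diff)
        finally show ?thesis .
      qed
    qed (use \<epsilon> \<open>(1 + \<epsilon>) * exp ?c < a\<close> in auto)
  qed
qed

text \<open>On the circle \<open>z * cnj z = 1\<close>, so the product of the two tails loses a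
  degree on each side. The remaining term with a conjugated polynomial is itself conjugated, which
  preserves its real part.\<close>

lemma Re_poly_mult_cnj:
  "\<exists>R. \<forall>z\<in>unit_circle. Re (poly P z * cnj (poly Q z)) = Re (poly R z)"
proof (induction P arbitrary: Q)
  case 0
  show ?case by (intro exI[of _ 0]) simp
next
  case (pCons a P)
  obtain b Q' where Q: "Q = pCons b Q'" by (cases Q)
  obtain R where R: "\<And>z. z \<in> unit_circle \<Longrightarrow> Re (poly P z * cnj (poly Q' z)) = Re (poly R z)"
    using pCons.IH by blast
  have "Re (poly (pCons a P) z * cnj (poly Q z))
      = Re (poly (smult (cnj a) Q + smult (cnj b) (pCons 0 P) + R) z)" if z: "z \<in> unit_circle" for z
  proof -
    have zz: "z * cnj z = 1" using z by (simp add: complex_norm_square[symmetric])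
    have "poly (pCons a P) z * cnj (poly Q z)
      = a * cnj (poly Q z) + cnj b * (z * poly P z) + (z * cnj z) * (poly P z * cnj (poly Q' z))"
      by (simp add: Q algebra_simps)
    moreover have "Re (a * cnj (poly Q z)) = Re (cnj a * poly Q z)"
      by simp
    ultimately show ?thesis
      using R[OF z] unfolding zz by (simp add: algebra_simps)
  qed
  then show ?case by blast
qed

text \<open>Twice the product of the real parts of \<open>u\<close> and \<open>v\<close> is
  \<open>Re (u * v) + Re (u * cnj v)\<close>.\<close>

lemma Re_poly_mult:
  "\<exists>R. \<forall>z\<in>unit_circle. Re (poly P z) * Re (poly Q z) = Re (poly R z)"
proof -
  obtain R where R: "\<And>z. z \<in> unit_circle \<Longrightarrow> Re (poly P z * cnj (poly Q z)) = Re (poly R z)"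
    using Re_poly_mult_cnj by blast
  have "Re (poly P z) * Re (poly Q z) = Re (poly (smult (1/2) (P * Q + R)) z)"
    if "z \<in> unit_circle" for z
    using R[OF that] by simp
  then show ?thesis by blast
qed

text \<open>By \<open>Re_poly_mult\<close>, real parts of polynomials form an algebra on the circle.
  It contains \<open>Re z\<close> and \<open>Im z\<close>, the real parts of \<open>z\<close> and
  \<open>- \<i> * z\<close>, hence every real linear function.\<close>

lemma real_polynomial_function_circle:
  fixes g :: "complex \<Rightarrow> real"
  assumes "real_polynomial_function g"
  shows "\<exists>P. \<forall>z\<in>unit_circle. g z = Re (poly P z)"
  using assms
proof induction
  case (linear g)
  interpret bounded_linear g by fact
  have "g z = Re (poly [:0, Complex (g 1) (- g \<i>):] z)" for z
  proof -
    have "g z = g (Re z *\<^sub>R 1 + Im z *\<^sub>R \<i>)"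
      by (rule arg_cong[of _ _ g]) (simp add: complex_eq_iff)
    also have "\<dots> = Re z * g 1 + Im z * g \<i>" unfolding add scaleR by simp
    finally show ?thesis by simp
  qed
  then show ?case by blast
next
  case (const c)
  show ?case by (intro exI[of _ "[:of_real c:]"]) simp
next
  case (add g h)
  then obtain P Q where "\<forall>z\<in>unit_circle. g z = Re (poly P z)" "\<forall>z\<in>unit_circle. h z = Re (poly Q z)"
    by blast
  then show ?case by (intro exI[of _ "P + Q"]) simp
next
  case (mult g h)
  then obtain P Q where PQ: "\<forall>z\<in>unit_circle. g z = Re (poly P z)" "\<forall>z\<in>unit_circle. h z = Re (poly Q z)"
    by blast
  then show ?case using Re_poly_mult[of P Q] by auto
qed

lemma multiplier_continuous_circle:
  assumes "continuous_on unit_circle \<Phi>" "\<And>z. z \<in> unit_circle \<Longrightarrow> 0 < \<Phi> z"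
  shows "multiplier (\<lambda>x. \<Phi> (cis (- x)))"
proof -
  have "continuous_on Lam (\<lambda>x. \<Phi> (cis (- x)))"
    by (rule continuous_on_compose2[OF assms(1)]) (auto intro!: continuous_intros)
  then have adm: "admissible (\<lambda>x. \<Phi> (cis (- x)))" (is "admissible ?g")
    by (rule admissible_continuous) (auto intro: assms(2))
  note g = admissibleD[OF adm]
  have cl: "continuous_on unit_circle (\<lambda>z. ln (\<Phi> z))"
    using assms by (intro continuous_intros) force+
  \<comment> \<open>The last clause follows from the first two by integration, since the mean of the
    real part of a polynomial is that of its constant coefficient.\<close>
  have approx: "\<exists>P. (\<forall>x. Re (poly P (cis (- x))) \<le> ln (?g x) + \<delta>) \<and>
      (\<forall>x. ln (?g x) - \<delta> \<le> Re (poly P (cis (- x)))) \<and>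
      \<bar>Re (coeff P 0) - ln (G ?g)\<bar> \<le> \<delta>" if \<delta>: "\<delta> > 0" for \<delta>
  proof -
    obtain q where q: "real_polynomial_function q" "\<And>z. z \<in> unit_circle \<Longrightarrow> \<bar>ln (\<Phi> z) - q z\<bar> < \<delta>"
      using Stone_Weierstrass_real_polynomial_function[OF compact_sphere cl \<delta>] by blast
    obtain P where P: "\<And>z. z \<in> unit_circle \<Longrightarrow> q z = Re (poly P z)"
      using real_polynomial_function_circle[OF q(1)] by blast
    have 1: "\<bar>ln (?g x) - Re (poly P (cis (- x)))\<bar> < \<delta>" for x
      using q(2)[of "cis (- x)"] unfolding P[of "cis (- x)", simplified] by simp
    let ?u = "\<lambda>x. Re (poly P (cis (- x)))"
    have u: "L1 ?u" by (intro L1_continuous continuous_intros)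
    have "Lint (\<lambda>x. ln (?g x)) - 2 * pi * \<delta> = Lint (\<lambda>x. ln (?g x) - \<delta>)"
      using g(5) by (simp add: Lint_diff)
    also have "\<dots> \<le> Lint ?u"
      by (intro Lint_mono L1_diff g(5) u L1_const) (use 1 in \<open>simp add: abs_less_iff algebra_simps less_imp_le\<close>)
    finally have 2: "Lint (\<lambda>x. ln (?g x)) - 2 * pi * \<delta> \<le> 2 * pi * Re (coeff P 0)"
      by (simp add: Lint_Re_poly)
    have "2 * pi * Re (coeff P 0) = Lint ?u" by (simp add: Lint_Re_poly)
    also have "\<dots> \<le> Lint (\<lambda>x. ln (?g x) + \<delta>)"
      by (intro Lint_mono L1_add g(5) u L1_const) (use 1 in \<open>simp add: abs_less_iff algebra_simps less_imp_le\<close>)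
    also have "\<dots> = Lint (\<lambda>x. ln (?g x)) + 2 * pi * \<delta>"
      using g(5) by (simp add: Lint_add)
    finally have 3: "2 * pi * Re (coeff P 0) \<le> Lint (\<lambda>x. ln (?g x)) + 2 * pi * \<delta>" .
    have "\<bar>Re (coeff P 0) - ln (G ?g)\<bar> \<le> \<delta>"
      using 2 3 unfolding g(6) by (simp add: field_simps abs_le_iff)
    moreover have "Re (poly P (cis (- x))) \<le> ln (?g x) + \<delta>"
      "ln (?g x) - \<delta> \<le> Re (poly P (cis (- x)))" for x
      using 1[of x] by linarith+
    ultimately show ?thesis by blast
  qed
  have G: "G ?g > 0" using g(6) by simp
  have pos: "?g x > 0" for x by (rule assms(2)) simp
  show ?thesis
  proof (rule multiplier_sandwich[OF adm])
    fix a assume a: "a < G ?g"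
    \<comment> \<open>The given bound may be nonpositive; \<open>a'\<close> is a positive one, still
      below the geometric mean, whose logarithm can be used.\<close>
    define a' where "a' = max a (G ?g / 2)"
    have a': "0 < a'" "a \<le> a'" "a' < G ?g" using G a by (auto simp: a'_def)
    \<comment> \<open>One third of the gap pays for moving the polynomial below the logarithm, one
      for the error of its mean, and the last keeps the inequality strict.\<close>
    define \<delta> where "\<delta> = (ln (G ?g) - ln a') / 3"
    have \<delta>: "\<delta> > 0" using a' G by (simp add: \<delta>_def)
    obtain P where P: "\<And>x. Re (poly P (cis (- x))) \<le> ln (?g x) + \<delta>"
        "\<bar>Re (coeff P 0) - ln (G ?g)\<bar> \<le> \<delta>"
      using approx[OF \<delta>] by blast
    let ?Q = "P - [:of_real \<delta>:]"
    have "exp (Re (poly ?Q (cis (- x)))) \<le> ?g x" for x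
      using P(1)[of x] pos[of x] by (simp add: ln_ge_iff[symmetric] algebra_simps)
    moreover have "a < G (\<lambda>x. exp (Re (poly ?Q (cis (- x)))))"
    proof -
      have "ln a' < Re (coeff P 0) - \<delta>"
      proof -
        have "ln a' = ln (G ?g) - 3 * \<delta>" by (simp add: \<delta>_def field_simps)
        moreover have "ln (G ?g) - Re (coeff P 0) \<le> \<delta>" using P(2) by (simp add: abs_le_iff)
        ultimately show ?thesis using \<delta> by linarith
      qed
      then have "a' < exp (Re (coeff P 0) - \<delta>)"
        using a'(1) by (metis exp_less_cancel_iff exp_ln)
      then show ?thesis unfolding G_exp_poly using a'(2) by simp
    qed
    ultimately show "\<exists>\<phi>. multiplier \<phi> \<and> (\<forall>x\<in>Lam. \<phi> x \<le> ?g x) \<and> a < G \<phi>"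
      using multiplier_exp_poly by blast
  next
    fix a assume a: "G ?g < a"
    define \<delta> where "\<delta> = (ln a - ln (G ?g)) / 3"
    have \<delta>: "\<delta> > 0" using a G by (simp add: \<delta>_def)
    obtain P where P: "\<And>x. ln (?g x) - \<delta> \<le> Re (poly P (cis (- x)))"
        "\<bar>Re (coeff P 0) - ln (G ?g)\<bar> \<le> \<delta>"
      using approx[OF \<delta>] by blast
    let ?Q = "P + [:of_real \<delta>:]"
    have "?g x \<le> exp (Re (poly ?Q (cis (- x))))" for x
    proof -
      have "?g x = exp (ln (?g x))" using pos[of x] by simp
      also have "\<dots> \<le> exp (Re (poly ?Q (cis (- x))))"
        using P(1)[of x] by simp
      finally show ?thesis .
    qed
    moreover have "G (\<lambda>x. exp (Re (poly ?Q (cis (- x))))) < a"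
    proof -
      have "Re (coeff P 0) + \<delta> < ln a"
      proof -
        have "ln a = ln (G ?g) + 3 * \<delta>" by (simp add: \<delta>_def field_simps)
        moreover have "Re (coeff P 0) - ln (G ?g) \<le> \<delta>" using P(2) by (simp add: abs_le_iff)
        ultimately show ?thesis using \<delta> by linarith
      qed
      then have "exp (Re (coeff P 0) + \<delta>) < a"
        using a G by (metis exp_less_cancel_iff exp_ln less_trans)
      then show ?thesis unfolding G_exp_poly by simp
    qed
    ultimately show "\<exists>\<phi>. multiplier \<phi> \<and> (\<forall>x\<in>Lam. ?g x \<le> \<phi> x) \<and> G \<phi> < a"
      using multiplier_exp_poly by blast
  qed
qed

section \<open>Riemann integrable multipliers\<close>

abbreviation len :: "real set \<Rightarrow> real" where
  "len \<equiv> Henstock_Kurzweil_Integration.content"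

text \<open>A mesh bound is a gauge of constant radius, so \<open>h\<close> is gauge integrable;
  being bounded, it is absolutely and thus Lebesgue integrable.\<close>

lemma riemann_integrable_imp_L1:
  assumes "riemann_integrable h Lam" "\<And>x. x \<in> Lam \<Longrightarrow> \<bar>h x\<bar> \<le> M"
  shows "L1 h"
proof -
  obtain I where I: "\<And>e. e > 0 \<Longrightarrow> \<exists>d>0. \<forall>D. D tagged_division_of Lam \<and> (\<lambda>x. ball x d) fine D \<longrightarrow>
      \<bar>(\<Sum>(x, K)\<in>D. len K * h x) - I\<bar> < e"
    using assms(1) unfolding riemann_integrable_def by blast
  have "(h has_integral I) Lam"
    unfolding Lam_def has_integral_real
  proof (intro allI impI)
    fix e :: real assume "e > 0"
    then obtain d where "d > 0" "\<And>D. D tagged_division_of {-pi..pi} \<and> (\<lambda>x. ball x d) fine D \<longrightarrow>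
        \<bar>(\<Sum>(x, K)\<in>D. len K * h x) - I\<bar> < e"
      using I unfolding Lam_def by blast
    then show "\<exists>\<gamma>. gauge \<gamma> \<and> (\<forall>\<D>. \<D> tagged_division_of {-pi..pi} \<and> \<gamma> fine \<D> \<longrightarrow>
        norm ((\<Sum>(x, k)\<in>\<D>. len k *\<^sub>R h x) - I) < e)"
      by (intro exI[of _ "\<lambda>x. ball x d"]) (auto simp: gauge_ball)
  qed
  then have "h integrable_on Lam" by blast
  moreover have "(\<lambda>x. M) integrable_on Lam" unfolding Lam_def by (rule integrable_const_ivl)
  ultimately have "h absolutely_integrable_on Lam"
    using assms(2) by (intro absolutely_integrable_integrable_bound[where g = "\<lambda>_. M"]) auto
  then show ?thesis
    unfolding L1_def by (rule absolutely_integrable_imp_integrable) simp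
qed

lemma L1_has_integral: "L1 h \<Longrightarrow> (h has_integral Lint h) Lam"
  unfolding L1_def Lint_def by (rule has_integral_integral_lebesgue_on) simp_all

text \<open>Retagging a fine division with points that nearly attain the infima of \<open>h\<close>
  turns its Riemann sum into a lower Darboux sum, up to a small error.\<close>

lemma riemann_lower_sum:
  assumes ri: "riemann_integrable h Lam" and bd: "\<And>x. x \<in> Lam \<Longrightarrow> \<bar>h x\<bar> \<le> M" and "e > 0"
  shows "\<exists>\<D>. \<D> division_of Lam \<and> Lint h - e < (\<Sum>K\<in>\<D>. len K * (INF y\<in>K. h y))"
proof -
  \<comment> \<open>The error is made of \<open>2 * \<epsilon>\<close> from comparing
    \<open>I\<close> with \<open>Lint h\<close>, \<epsilon> from the Riemann sum, and
    \<open>2 * pi * \<epsilon>\<close> from the tags.\<close>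
  define \<epsilon> where "\<epsilon> = e / (3 + 2 * pi)"
  have "3 + 2 * pi > 0" using pi_gt_zero by linarith
  then have \<epsilon>: "\<epsilon> > 0" "3 * \<epsilon> + 2 * pi * \<epsilon> = e"
    using \<open>e > 0\<close> by (simp_all add: \<epsilon>_def add_divide_distrib[symmetric])
      (simp add: divide_eq_eq algebra_simps)
  obtain I where I: "\<And>e. e > 0 \<Longrightarrow> \<exists>d>0. \<forall>D. D tagged_division_of Lam \<and> (\<lambda>x. ball x d) fine D \<longrightarrow>
      \<bar>(\<Sum>(x, K)\<in>D. len K * h x) - I\<bar> < e"
    using ri unfolding riemann_integrable_def by blast
  obtain d where d: "d > 0" "\<And>D. D tagged_division_of Lam \<Longrightarrow> (\<lambda>x. ball x d) fine D \<Longrightarrow>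
      \<bar>(\<Sum>(x, K)\<in>D. len K * h x) - I\<bar> < \<epsilon>"
    using I[OF \<epsilon>(1)] by blast
  have hi: "(h has_integral Lint h) Lam"
    by (rule L1_has_integral[OF riemann_integrable_imp_L1[OF ri bd]])
  obtain \<gamma> where \<gamma>: "gauge \<gamma>" "\<And>D. D tagged_division_of Lam \<Longrightarrow> \<gamma> fine D \<Longrightarrow>
      \<bar>(\<Sum>(x, K)\<in>D. len K * h x) - Lint h\<bar> < \<epsilon>"
    using hi[unfolded Lam_def has_integral_real, rule_format, OF \<epsilon>(1)] unfolding Lam_def by auto
  \<comment> \<open>A division fine for both gauges has a sum within \<epsilon> of \<open>I\<close>
    and of \<open>Lint h\<close>.\<close>
  have "I > Lint h - 2 * \<epsilon>"
  proof -
    have "gauge (\<lambda>x. ball x d \<inter> \<gamma> x)" by (intro gauge_Int \<gamma> gauge_ball d)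
    then obtain p where "p tagged_division_of Lam" "(\<lambda>x. ball x d \<inter> \<gamma> x) fine p"
      unfolding Lam_def by (rule fine_division_exists_real)
    then show ?thesis
      using d(2)[of p] \<gamma>(2)[of p] by (simp add: fine_Int)
  qed
  \<comment> \<open>Half the radius leaves room for moving the tags: a cell inside a ball of radius
    \<open>d / 2\<close> lies within distance \<open>d\<close> of each of its points.\<close>
  have "gauge (\<lambda>x::real. ball x (d / 2))" using d by (intro gauge_ball) simp
  then obtain p where p: "p tagged_division_of Lam" "(\<lambda>x. ball x (d / 2)) fine p"
    unfolding Lam_def by (rule fine_division_exists_real)
  define \<D> where "\<D> = snd ` p"
  have \<D>: "\<D> division_of Lam"
    unfolding \<D>_def by (rule division_of_tagged_division[OF p(1)])
  note D = division_ofD[OF \<D>]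
  have "\<exists>t\<in>K. h t < (INF y\<in>K. h y) + \<epsilon>" if "K \<in> \<D>" for K
  proof -
    have "bdd_below (h ` K)"
      using D(2)[OF that] bd by (intro bdd_belowI2[of _ "- M"]) (force simp: abs_le_iff)
    then show ?thesis
      using cInf_lessD[of "h ` K" "(INF y\<in>K. h y) + \<epsilon>"] D(3)[OF that] \<epsilon> by auto
  qed
  then obtain t where t: "\<And>K. K \<in> \<D> \<Longrightarrow> t K \<in> K" "\<And>K. K \<in> \<D> \<Longrightarrow> h (t K) < (INF y\<in>K. h y) + \<epsilon>"
    by metis
  let ?D = "(\<lambda>K. (t K, K)) ` \<D>"
  have "?D tagged_division_of Lam"
  proof (rule tagged_division_ofI)
    show "finite ?D" using D(1) by simp
    show "x \<in> K" "K \<subseteq> Lam" "\<exists>a b. K = cbox a b" if "(x, K) \<in> ?D" for x K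
      using that t(1) D(2,4) by auto
    show "interior K1 \<inter> interior K2 = {}"
      if "(x1, K1) \<in> ?D" "(x2, K2) \<in> ?D" "(x1, K1) \<noteq> (x2, K2)" for x1 K1 x2 K2
      using that D(5)[of K1 K2] by blast
    have "{K. \<exists>x. (x, K) \<in> ?D} = \<D>" by auto
    then show "\<Union> {K. \<exists>x. (x, K) \<in> ?D} = Lam" using D(6) by simp
  qed
  moreover have "(\<lambda>x. ball x d) fine ?D"
  proof (rule fineI, clarsimp)
    fix K y assume K: "K \<in> \<D>" and y: "y \<in> K"
    then obtain x where "(x, K) \<in> p" by (auto simp: \<D>_def)
    then have "K \<subseteq> ball x (d / 2)" using p(2) by (auto simp: fine_def)
    then have "dist x y < d / 2" "dist x (t K) < d / 2" using y t(1)[OF K] by auto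
    then show "dist (t K) y < d" by (metis dist_commute dist_triangle_half_r)
  qed
  ultimately have "\<bar>(\<Sum>(x, K)\<in>?D. len K * h x) - I\<bar> < \<epsilon>" by (rule d(2))
  moreover have "(\<Sum>(x, K)\<in>?D. len K * h x) = (\<Sum>K\<in>\<D>. len K * h (t K))"
    by (subst sum.reindex) (auto simp: inj_on_def)
  moreover have "(\<Sum>K\<in>\<D>. len K * h (t K)) \<le> (\<Sum>K\<in>\<D>. len K * ((INF y\<in>K. h y) + \<epsilon>))"
    using t(2) by (intro sum_mono mult_left_mono) (auto intro: less_imp_le)
  moreover have "(\<Sum>K\<in>\<D>. len K * ((INF y\<in>K. h y) + \<epsilon>)) = (\<Sum>K\<in>\<D>. len K * (INF y\<in>K. h y)) + (\<Sum>K\<in>\<D>. len K) * \<epsilon>"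
    by (simp add: distrib_left sum.distrib sum_distrib_right)
  moreover have "(\<Sum>K\<in>\<D>. len K) = 2 * pi"
    using additive_content_division[of \<D> "-pi" pi] \<D> by (simp add: Lam_def)
  ultimately have "Lint h - e < (\<Sum>K\<in>\<D>. len K * (INF y\<in>K. h y))"
    using \<open>I > Lint h - 2 * \<epsilon>\<close> \<epsilon>(2) by (simp add: abs_less_iff)
  then show ?thesis using \<D> by blast
qed

section \<open>Lower approximation by Lipschitz envelopes\<close>

text \<open>Going round the circle identifies only the two end points of \<open>Lam\<close>, so
  \<open>x\<close> is kept in the interior.\<close>

lemma cis_inj_Lam:
  assumes "-pi < x" "x < pi" "y \<in> Lam" "cis (- x) = cis (- y)"
  shows "x = y"
proof -
  have "cis (y - x) = 1"
    using assms(4) by (metis cis_divide cis_neq_zero diff_minus_eq_add divide_self minus_diff_commute uminus_add_conv_diff)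
  then have "cos (y - x) = 1" by (simp add: complex_eq_iff)
  then obtain n :: int where n: "y - x = of_int n * (2 * pi)"
    by (auto simp: cos_one_2pi_int)
  have "\<bar>y - x\<bar> < 2 * pi" using assms by (auto simp: Lam_def)
  then have "\<bar>real_of_int n\<bar> < 1"
    using n pi_gt_zero by (simp add: abs_mult)
  then have "n = 0" by linarith
  then show ?thesis using n by simp
qed

text \<open>As n grows, these Lipschitz functions on the circle increase to the lower semicontinuous envelope of h.\<close>
definition lip_env :: "(real \<Rightarrow> real) \<Rightarrow> nat \<Rightarrow> complex \<Rightarrow> real" where
  "lip_env h n z = (INF y\<in>Lam. h y + real n * dist z (cis (- y)))"

lemma Lam_nonempty: "0 \<in> Lam" by (simp add: Lam_def)

lemma lip_env_bdd:
  assumes "\<And>x. x \<in> Lam \<Longrightarrow> m \<le> h x"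
  shows "bdd_below ((\<lambda>y. h y + real n * dist z (cis (- y))) ` Lam)"
  using assms by (intro bdd_belowI2[where m = m]) (auto intro: add_increasing2)

lemma lip_env_ge:
  assumes "\<And>y. y \<in> Lam \<Longrightarrow> s \<le> h y + real n * dist z (cis (- y))"
  shows "s \<le> lip_env h n z"
  unfolding lip_env_def using assms Lam_nonempty by (intro cINF_greatest) auto

lemma lip_env_le:
  assumes "\<And>x. x \<in> Lam \<Longrightarrow> m \<le> h x" "y \<in> Lam"
  shows "lip_env h n z \<le> h y + real n * dist z (cis (- y))"
  unfolding lip_env_def by (intro cINF_lower lip_env_bdd[where m = m] assms)

text \<open>An infimum of functions of \<open>z\<close> with common Lipschitz constant
  \<open>n\<close> keeps that constant.\<close>

lemma continuous_lip_env:
  assumes "\<And>x. x \<in> Lam \<Longrightarrow> m \<le> h x"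
  shows "continuous_on S (lip_env h n)"
proof -
  have *: "lip_env h n z - real n * dist z w \<le> lip_env h n w" for z w
  proof (rule lip_env_ge)
    fix y assume y: "y \<in> Lam"
    have "lip_env h n z \<le> h y + real n * dist z (cis (- y))"
      by (rule lip_env_le[OF assms y])
    also have "\<dots> \<le> h y + real n * (dist z w + dist w (cis (- y)))"
      by (intro add_left_mono mult_left_mono dist_triangle) auto
    finally show "lip_env h n z - real n * dist z w \<le> h y + real n * dist w (cis (- y))"
      by (simp add: algebra_simps)
  qed
  have "dist (lip_env h n z) (lip_env h n w) \<le> real n * dist z w" for z w
    using *[of z w] *[of w z] by (simp add: dist_real_def abs_le_iff dist_commute)
  then have "(real n)-lipschitz_on S (lip_env h n)"
    by (intro lipschitz_onI) auto
  then show ?thesis by (rule lipschitz_on_continuous_on)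
qed

text \<open>Points of \<open>Lam\<close> outside the open interval stay at a positive distance from
  \<open>x\<close> on the circle, so for large \<open>n\<close> the penalty lifts their terms to
  \<open>s\<close>; inside the interval \<open>h\<close> alone suffices.\<close>

lemma lip_env_reaches:
  assumes "\<And>x. x \<in> Lam \<Longrightarrow> m \<le> h x" "{a..b} \<subseteq> Lam" "\<And>y. y \<in> {a..b} \<Longrightarrow> s \<le> h y" "x \<in> {a<..<b}"
  shows "\<exists>n. s \<le> lip_env h n (cis (- x))"
proof -
  let ?C = "{- pi..pi} - {a<..<b}"
  have "compact ?C" by (intro compact_diff) auto
  moreover have "continuous_on ?C (\<lambda>y. dist (cis (- x)) (cis (- y)))"
    by (intro continuous_intros)
  ultimately have c: "compact ((\<lambda>y. dist (cis (- x)) (cis (- y))) ` ?C)"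
    by (intro compact_continuous_image)
  have x: "- pi < x" "x < pi" using subsetD[OF assms(2), of a] subsetD[OF assms(2), of b] assms(4) by (auto simp: Lam_def)
  have "0 \<notin> (\<lambda>y. dist (cis (- x)) (cis (- y))) ` ?C"
    using cis_inj_Lam[OF x] assms(4) by (auto simp: Lam_def)
  from separate_point_closed[OF compact_imp_closed[OF c] this]
  obtain \<delta> where \<delta>: "\<delta> > 0" "\<And>y. y \<in> ?C \<Longrightarrow> \<delta> \<le> dist (cis (- x)) (cis (- y))"
    by auto
  \<comment> \<open>The penalty must make up at most \<open>s - m\<close>, as \<open>h\<close> is at
    least \<open>m\<close>.\<close>
  obtain n :: nat where n: "(s - m) / \<delta> \<le> real n" using real_arch_simple by blast
  have "s \<le> lip_env h n (cis (- x))"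
  proof (rule lip_env_ge)
    fix y assume y: "y \<in> Lam"
    show "s \<le> h y + real n * dist (cis (- x)) (cis (- y))"
    proof (cases "y \<in> {a..b}")
      case True
      then show ?thesis using assms(3)[OF True] by (simp add: add_increasing2)
    next
      case False
      then have "\<delta> \<le> dist (cis (- x)) (cis (- y))"
        using y by (intro \<delta>(2)) (auto simp: Lam_def)
      then have "real n * \<delta> \<le> real n * dist (cis (- x)) (cis (- y))"
        by (intro mult_left_mono) auto
      moreover have "s - m \<le> real n * \<delta>" using n \<delta>(1) by (simp add: field_simps)
      ultimately show ?thesis using assms(1)[OF y] by linarith
    qed
  qed
  then show ?thesis by blast
qed

text \<open>The envelopes increase to a limit \<open>L\<close> that is at least the infimum of
  \<open>h\<close> in the interior of each cell, so the integral of \<open>L\<close> dominates every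
  lower Darboux sum. Dominated convergence then yields a single envelope.\<close>

lemma riemann_lower_approx:
  assumes ri: "riemann_integrable h Lam" and bd: "\<And>x. x \<in> Lam \<Longrightarrow> m \<le> h x \<and> h x \<le> M" and "e > 0"
  shows "\<exists>\<Phi>. continuous_on unit_circle \<Phi> \<and> (\<forall>z. m \<le> \<Phi> z) \<and>
    (\<forall>x\<in>Lam. \<Phi> (cis (- x)) \<le> h x) \<and> Lint h - e < Lint (\<lambda>x. \<Phi> (cis (- x)))"
proof -
  have lo: "\<And>x. x \<in> Lam \<Longrightarrow> m \<le> h x" using bd by blast
  have bd': "\<bar>h x\<bar> \<le> max \<bar>m\<bar> \<bar>M\<bar>" if "x \<in> Lam" for x using bd[OF that] by auto
  let ?\<phi> = "\<lambda>n x. lip_env h n (cis (- x))"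
  define L where "L x = (SUP n. ?\<phi> n x)" for x
  have ge: "m \<le> lip_env h n z" for n z
    using lo by (intro lip_env_ge) (auto intro: add_increasing2)
  have le: "?\<phi> n x \<le> h x" if "x \<in> Lam" for n x
    using lip_env_le[OF lo that, where n = n and z = "cis (- x)"] by simp
  have inc: "incseq (\<lambda>n. ?\<phi> n x)" for x
  proof (rule incseq_SucI, rule lip_env_ge)
    fix n y assume y: "y \<in> Lam"
    have "?\<phi> n x \<le> h y + real n * dist (cis (- x)) (cis (- y))"
      by (rule lip_env_le[OF lo y])
    then show "?\<phi> n x \<le> h y + real (Suc n) * dist (cis (- x)) (cis (- y))"
      by (rule order_trans) (simp add: distrib_right)
  qed
  have bdd: "bdd_above (range (\<lambda>n. ?\<phi> n x))" if "x \<in> Lam" for x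
    using le[OF that] by (intro bdd_aboveI2)
  have lim: "(\<lambda>n. ?\<phi> n x) \<longlonglongrightarrow> L x" if "x \<in> Lam" for x
    unfolding L_def by (rule LIMSEQ_incseq_SUP[OF bdd[OF that] inc])
  have Lh: "m \<le> L x" "L x \<le> h x" if "x \<in> Lam" for x
    using LIMSEQ_le_const[OF lim[OF that]] LIMSEQ_le_const2[OF lim[OF that]] ge le[OF that] by blast+
  have cont: "continuous_on Lam (?\<phi> n)" for n
    by (intro continuous_on_compose2[OF continuous_lip_env[OF lo, where S = UNIV]] continuous_intros) auto
  have meas: "?\<phi> n \<in> borel_measurable (lebesgue_on Lam)" for n
    by (rule measurable_Lam_continuous[OF cont])
  have mL: "L \<in> borel_measurable (lebesgue_on Lam)"
    by (rule borel_measurable_LIMSEQ_real[OF _ meas]) (use lim in simp)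
  have L1L: "L1 L"
    by (rule L1_bounded[OF mL, of "max \<bar>m\<bar> \<bar>M\<bar>"]) (use Lh bd in fastforce)
  have conv: "(\<lambda>n. Lint (?\<phi> n)) \<longlonglongrightarrow> Lint L"
    unfolding Lint_def
  proof (rule integral_dominated_convergence[where w = "\<lambda>_. max \<bar>m\<bar> \<bar>M\<bar>"])
    show "integrable (lebesgue_on Lam) (\<lambda>_. max \<bar>m\<bar> \<bar>M\<bar>)"
      using L1_const by (simp only: L1_def)
    show "AE x in lebesgue_on Lam. (\<lambda>n. ?\<phi> n x) \<longlonglongrightarrow> L x"
      using lim by (intro AE_I2) simp
    show "AE x in lebesgue_on Lam. norm (?\<phi> n x) \<le> max \<bar>m\<bar> \<bar>M\<bar>" for n
    proof (intro AE_I2)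
      fix x assume "x \<in> space (lebesgue_on Lam)"
      then have "x \<in> Lam" by simp
      then show "norm (?\<phi> n x) \<le> max \<bar>m\<bar> \<bar>M\<bar>"
        using ge[of n "cis (- x)"] le[of x n] bd[of x] by auto
    qed
  qed (use mL meas in auto)
  obtain \<D> where \<D>: "\<D> division_of Lam" "Lint h - e < (\<Sum>K\<in>\<D>. len K * (INF y\<in>K. h y))"
    using riemann_lower_sum[OF ri bd' \<open>e > 0\<close>] by blast
  note D = division_ofD[OF \<D>(1)]
  have Li: "L integrable_on Lam" "integral Lam L = Lint L"
    using L1_has_integral[OF L1L] by (auto simp: integral_unique)
  have "len K * (INF y\<in>K. h y) \<le> integral K L" if K: "K \<in> \<D>" for K
  proof -
    obtain a b where ab: "K = {a..b}" using D(4)[OF K] by auto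
    with D(3)[OF K] have "a \<le> b" by auto
    have sub: "{a..b} \<subseteq> Lam" using D(2)[OF K] ab by simp
    let ?s = "INF y\<in>K. h y"
    have bb: "bdd_below (h ` K)"
      using sub lo ab by (intro bdd_belowI2[of _ m]) auto
    have s: "?s \<le> h y" if "y \<in> {a..b}" for y
      using that ab by (intro cINF_lower[OF bb]) auto
    have "?s \<le> L x" if x: "x \<in> {a<..<b}" for x
    proof -
      obtain n where "?s \<le> ?\<phi> n x"
        using lip_env_reaches[of m h a b ?s x] lo sub s x by blast
      also have "\<dots> \<le> L x"
        unfolding L_def using x sub by (intro cSUP_upper bdd) auto
      finally show ?thesis .
    qed
    \<comment> \<open>The comparison is known only inside the cell; the end points do not change the
      integrals.\<close>
    moreover have "L integrable_on {a<..<b}"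
      unfolding integrable_on_open_interval_real
      by (rule integrable_on_subinterval[OF Li(1) sub])
    moreover have "(\<lambda>_. ?s) integrable_on {a<..<b}"
      unfolding integrable_on_open_interval_real by (rule integrable_const_ivl)
    ultimately have "integral {a<..<b} (\<lambda>_. ?s) \<le> integral {a<..<b} L"
      by (intro integral_le) auto
    then have "integral {a..b} (\<lambda>_. ?s) \<le> integral {a..b} L"
      by (simp only: integral_open_interval_real)
    then show ?thesis using \<open>a \<le> b\<close> by (simp add: ab)
  qed
  then have "(\<Sum>K\<in>\<D>. len K * (INF y\<in>K. h y)) \<le> (\<Sum>K\<in>\<D>. integral K L)"
    by (rule sum_mono)
  also have "\<dots> = Lint L"
    using integral_combine_division_topdown[OF Li(1) \<D>(1)] Li(2) by simp
  finally have "Lint h - e < Lint L" using \<D>(2) by linarith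
  then have "eventually (\<lambda>n. Lint h - e < Lint (?\<phi> n)) sequentially"
    using conv by (rule order_tendstoD(1)[rotated])
  then obtain n where "Lint h - e < Lint (?\<phi> n)"
    by (auto simp: eventually_sequentially)
  then show ?thesis
    using continuous_lip_env[OF lo] ge le by (intro exI[of _ "lip_env h n"]) auto
qed

lemma riemann_integrable_uminus:
  assumes "riemann_integrable h S"
  shows "riemann_integrable (\<lambda>x. - h x) S"
proof -
  obtain I where I: "\<forall>e>0. \<exists>d>0. \<forall>D. D tagged_division_of S \<and> (\<lambda>x. ball x d) fine D \<longrightarrow>
      \<bar>(\<Sum>(x, K)\<in>D. len K * h x) - I\<bar> < e"
    using assms unfolding riemann_integrable_def by blast
  have "(\<Sum>(x, K)\<in>D. len K * - h x) = - (\<Sum>(x, K)\<in>D. len K * h x)" for D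
    by (simp add: sum_negf case_prod_unfold)
  then have "\<bar>(\<Sum>(x, K)\<in>D. len K * - h x) - (- I)\<bar> = \<bar>(\<Sum>(x, K)\<in>D. len K * h x) - I\<bar>" for D
    by (simp add: abs_minus_commute)
  then show ?thesis
    unfolding riemann_integrable_def using I by (intro exI[of _ "- I"]) simp
qed

text \<open>From \<open>ln u \<le> u - 1\<close> at \<open>u = h x / g x\<close> and
  \<open>c \<le> g x\<close>, the difference of the logarithms is at most
  \<open>(h x - g x) / c\<close>. Closeness of integrals thus passes to geometric means.\<close>

lemma G_le_of_Lint_diff:
  assumes "admissible g" "admissible h" "c > 0"
    and g: "L1 g" "\<And>x. x \<in> Lam \<Longrightarrow> c \<le> g x" and h: "L1 h" "\<And>x. x \<in> Lam \<Longrightarrow> g x \<le> h x"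
    and "Lint h - Lint g \<le> 2 * pi * c * \<delta>"
  shows "G h \<le> G g * exp \<delta>"
proof -
  note G = admissibleD[OF assms(1)] and H = admissibleD[OF assms(2)]
  have "Lint (\<lambda>x. ln (h x) - ln (g x)) \<le> Lint (\<lambda>x. 1 / c * (h x - g x))"
  proof (intro Lint_mono L1_diff L1_cmult G(5) H(5) g(1) h(1))
    fix x assume x: "x \<in> Lam"
    have p: "0 < g x" "g x \<le> h x" "c \<le> g x" using g(2) h(2) x \<open>c > 0\<close> by force+
    have "ln (h x) - ln (g x) = ln (h x / g x)" using p by (simp add: ln_div)
    also have "\<dots> \<le> h x / g x - 1" using p by (intro ln_le_minus_one) auto
    also have "\<dots> = (h x - g x) / g x" using p by (simp add: field_simps)
    also have "\<dots> \<le> (h x - g x) / c" using p \<open>c > 0\<close> by (intro divide_left_mono) auto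
    finally show "ln (h x) - ln (g x) \<le> 1 / c * (h x - g x)" by simp
  qed
  also have "\<dots> = 1 / c * (Lint h - Lint g)"
    by (simp only: Lint_cmult Lint_diff[OF h(1) g(1)])
  also have "\<dots> \<le> 2 * pi * \<delta>" using assms(8) \<open>c > 0\<close> by (simp add: field_simps)
  finally have "Lint (\<lambda>x. ln (h x)) \<le> Lint (\<lambda>x. ln (g x)) + 2 * pi * \<delta>"
    using Lint_diff[OF H(5) G(5)] by simp
  then have "1 / (2 * pi) * Lint (\<lambda>x. ln (h x)) \<le> 1 / (2 * pi) * (Lint (\<lambda>x. ln (g x)) + 2 * pi * \<delta>)"
    by (intro mult_left_mono) auto
  also have "\<dots> = 1 / (2 * pi) * Lint (\<lambda>x. ln (g x)) + \<delta>"
    by (simp add: field_simps)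
  finally show ?thesis
    unfolding G(6) H(6) by (simp add: exp_add[symmetric])
qed

text \<open>Continuous functions below \<open>h\<close> come from
  \<open>riemann_lower_approx\<close>, those above from the same lemma for \<open>- h\<close>;
  \<open>G_le_of_Lint_diff\<close> controls their geometric means.\<close>

lemma multiplier_classBpm:
  assumes "classBpm h"
  shows "multiplier h"
proof -
  obtain m M where mM: "0 < m" "m \<le> M" and bd: "\<And>x. x \<in> Lam \<Longrightarrow> m \<le> h x \<and> h x \<le> M"
    and ri: "riemann_integrable h Lam"
    using assms by (auto simp: classBpm_def classB_def)
  have L1h: "L1 h"
    by (rule riemann_integrable_imp_L1[OF ri, of M]) (use bd mM in fastforce)
  have meas: "h \<in> borel_measurable (lebesgue_on Lam)"
    using L1h by (auto simp: L1_def)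
  have pos: "0 < h x" if "x \<in> Lam" for x using bd[OF that] mM by linarith
  have adm: "admissible h"
    unfolding admissible_def
  proof (intro conjI)
    show "L1 (\<lambda>x. ln (h x))"
    proof (rule L1_bounded)
      show "\<bar>ln (h x)\<bar> \<le> max \<bar>ln m\<bar> \<bar>ln M\<bar>" if "x \<in> Lam" for x
      proof -
        have "ln m \<le> ln (h x)" "ln (h x) \<le> ln M" using bd[OF that] pos[OF that] mM by simp_all
        then show ?thesis by linarith
      qed
    qed (use meas in measurable)
    show "\<exists>M. \<forall>x\<in>Lam. 0 \<le> h x \<and> h x \<le> M" using bd pos less_imp_le by blast
    show "AE x in lebesgue_on Lam. 0 < h x" using pos by (intro AE_I2) simp
  qed (rule meas)
  have G: "G h > 0" using admissibleD(6)[OF adm] by simp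
  have cont: "continuous_on Lam (\<lambda>x. \<Phi> (cis (- x)))" if "continuous_on unit_circle \<Phi>" for \<Phi> :: "complex \<Rightarrow> real"
    by (rule continuous_on_compose2[OF that]) (auto intro!: continuous_intros)
  show ?thesis
  proof (rule multiplier_sandwich[OF adm])
    fix a assume a: "a < G h"
    define a' where "a' = max a (G h / 2)"
    have a': "0 < a'" "a \<le> a'" "a' < G h" using G a by (auto simp: a'_def)
    define \<delta> where "\<delta> = ln (G h / a') / 2"
    have \<delta>: "\<delta> > 0" "\<delta> < ln (G h / a')" using a' G by (auto simp: \<delta>_def)
    obtain \<Phi> where \<Phi>: "continuous_on unit_circle \<Phi>" "\<And>z. m \<le> \<Phi> z"
      "\<And>x. x \<in> Lam \<Longrightarrow> \<Phi> (cis (- x)) \<le> h x" "Lint h - 2 * pi * m * \<delta> < Lint (\<lambda>x. \<Phi> (cis (- x)))"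
      using riemann_lower_approx[OF ri bd, of "2 * pi * m * \<delta>"] \<delta>(1) mM(1) by auto
    have mult: "multiplier (\<lambda>x. \<Phi> (cis (- x)))"
      using \<Phi>(1,2) mM(1) by (intro multiplier_continuous_circle) (auto intro: less_le_trans)
    have "G h \<le> G (\<lambda>x. \<Phi> (cis (- x))) * exp \<delta>"
      by (rule G_le_of_Lint_diff[OF _ adm mM(1) L1_continuous[OF cont[OF \<Phi>(1)]] \<Phi>(2) L1h \<Phi>(3)])
         (use mult \<Phi>(4) in \<open>auto simp: multiplier_def\<close>)
    moreover have "exp \<delta> < G h / a'"
      using \<delta>(2) a' G by (metis divide_pos_pos exp_less_cancel_iff exp_ln)
    then have "a' * exp \<delta> < G h" using a'(1) by (simp add: field_simps)
    ultimately have "a' * exp \<delta> < G (\<lambda>x. \<Phi> (cis (- x))) * exp \<delta>" by linarith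
    then have "a < G (\<lambda>x. \<Phi> (cis (- x)))" using a'(2) by simp
    then show "\<exists>\<phi>. multiplier \<phi> \<and> (\<forall>x\<in>Lam. \<phi> x \<le> h x) \<and> a < G \<phi>"
      using mult \<Phi>(3) by blast
  next
    fix a assume a: "G h < a"
    define \<delta> where "\<delta> = ln (a / G h) / 2"
    have \<delta>: "\<delta> > 0" "\<delta> < ln (a / G h)" using a G by (auto simp: \<delta>_def)
    have bd': "- M \<le> - h x \<and> - h x \<le> - m" if "x \<in> Lam" for x using bd[OF that] by simp
    obtain \<Psi> where \<Psi>: "continuous_on unit_circle \<Psi>"
      "\<And>x. x \<in> Lam \<Longrightarrow> \<Psi> (cis (- x)) \<le> - h x"
      "Lint (\<lambda>x. - h x) - 2 * pi * m * \<delta> < Lint (\<lambda>x. \<Psi> (cis (- x)))"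
      using riemann_lower_approx[OF riemann_integrable_uminus[OF ri] bd', of "2 * pi * m * \<delta>"] \<delta>(1) mM(1)
      by auto
    \<comment> \<open>The maximum makes positivity immediate. At \<open>cis (- x)\<close> with
      \<open>x\<close> in \<open>Lam\<close> it changes nothing, because \<open>- \<Psi>\<close> is
      at least \<open>h x\<close> there.\<close>
    define \<Phi> where "\<Phi> z = max m (- \<Psi> z)" for z
    have c: "continuous_on unit_circle \<Phi>" unfolding \<Phi>_def by (intro continuous_intros \<Psi>(1))
    have ge: "h x \<le> \<Phi> (cis (- x))" if "x \<in> Lam" for x using \<Psi>(2)[OF that] by (simp add: \<Phi>_def)
    have eq: "\<Phi> (cis (- x)) = - \<Psi> (cis (- x))" if "x \<in> Lam" for x
      using \<Psi>(2)[OF that] bd[OF that] by (simp add: \<Phi>_def)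
    have "Lint (\<lambda>x. \<Phi> (cis (- x))) = Lint (\<lambda>x. - 1 * \<Psi> (cis (- x)))"
      using eq by (intro Lint_cong) simp
    also have "\<dots> = - Lint (\<lambda>x. \<Psi> (cis (- x)))" unfolding Lint_cmult by simp
    finally have d: "Lint (\<lambda>x. \<Phi> (cis (- x))) - Lint h \<le> 2 * pi * m * \<delta>"
      using \<Psi>(3) Lint_cmult[of "- 1" h] by simp
    have mult: "multiplier (\<lambda>x. \<Phi> (cis (- x)))"
      using mM(1) by (intro multiplier_continuous_circle c) (auto simp: \<Phi>_def)
    have "G (\<lambda>x. \<Phi> (cis (- x))) \<le> G h * exp \<delta>"
      by (rule G_le_of_Lint_diff[OF adm _ mM(1) L1h _ L1_continuous[OF cont[OF c]] ge d])
         (use mult bd in \<open>auto simp: multiplier_def\<close>)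
    moreover have "exp \<delta> < a / G h"
      using \<delta>(2) a G by (metis divide_pos_pos exp_less_cancel_iff exp_ln less_trans)
    then have "G h * exp \<delta> < a" using G by (simp add: field_simps)
    ultimately have "G (\<lambda>x. \<Phi> (cis (- x))) < a" by linarith
    then show "\<exists>\<phi>. multiplier \<phi> \<and> (\<forall>x\<in>Lam. h x \<le> \<phi> x) \<and> G \<phi> < a"
      using mult ge by blast
  qed
qed

section \<open>Multipliers with zeros\<close>

text \<open>Any two zeros differ by a multiple of \<open>2 * pi\<close>, so there are only countably
  many.\<close>

lemma AE_cis_neq: "AE x in lebesgue_on Lam. b * cis (- x) \<noteq> 1"
proof (cases "\<exists>x0. b * cis (- x0) = 1")
  case True
  then obtain x0 where x0: "b * cis (- x0) = 1" by blast
  have "{x. b * cis (- x) = 1} \<subseteq> range (\<lambda>n::int. x0 + of_int n * (2 * pi))"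
  proof
    fix x assume "x \<in> {x. b * cis (- x) = 1}"
    then have "b * cis (- x) = b * cis (- x0)" "b \<noteq> 0" using x0 by auto
    then have "cis (- x0) / cis (- x) = 1" by simp
    then have "cos (x - x0) = 1" by (simp add: cis_divide complex_eq_iff)
    then obtain n :: int where "x - x0 = of_int n * (2 * pi)"
      by (auto simp: cos_one_2pi_int)
    then have "x = x0 + of_int n * (2 * pi)" by simp
    then show "x \<in> range (\<lambda>n::int. x0 + of_int n * (2 * pi))" by blast
  qed
  then have "countable {x. b * cis (- x) = 1}"
    by (rule countable_subset) simp
  then have "{x. b * cis (- x) = 1} \<in> null_sets lebesgue"
    by (intro null_sets_completionI countable_imp_null_set_lborel)
  then have "AE x in lebesgue. x \<notin> {x. b * cis (- x) = 1}"
    by (rule AE_not_in)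
  then have "AE x in lebesgue. x \<in> Lam \<longrightarrow> b * cis (- x) \<noteq> 1"
    by eventually_elim simp
  then show ?thesis by (simp add: AE_restrict_space_iff)
qed simp

text \<open>The logarithmic series converges boundedly on the circle, and its partial sums are real
  parts of polynomials without constant term, which have mean 0.\<close>

lemma Lint_ln_inside:
  assumes "cmod b < 1"
  shows "L1 (\<lambda>x. ln (cmod (1 - b * cis (- x))))" "Lint (\<lambda>x. ln (cmod (1 - b * cis (- x)))) = 0"
proof -
  have nz: "1 - b * cis (- x) \<noteq> 0" for x
  proof
    assume "1 - b * cis (- x) = 0"
    then have "b * cis (- x) = 1" by simp
    then have "cmod (b * cis (- x)) = 1" by simp
    then show False using assms by (simp add: norm_mult)
  qed
  show L: "L1 (\<lambda>x. ln (cmod (1 - b * cis (- x))))"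
    by (intro L1_continuous continuous_intros) (use nz in auto)
  let ?r = "cmod b"
  \<comment> \<open>The term with \<open>k = 0\<close> vanishes because division by 0 gives
    0.\<close>
  let ?s = "\<lambda>n x. \<Sum>k<n. - Re ((b * cis (- x)) ^ k / of_nat k)"
  have lim: "(\<lambda>n. ?s n x) \<longlonglongrightarrow> ln (cmod (1 - b * cis (- x)))" for x
  proof -
    have "(\<lambda>n. - ((b * cis (- x)) ^ n) / of_nat n) sums Ln (1 - b * cis (- x))"
      using Ln_series'[of "- (b * cis (- x))"] assms by (simp add: norm_mult)
    then have "(\<lambda>n. Re (- ((b * cis (- x)) ^ n) / of_nat n)) sums Re (Ln (1 - b * cis (- x)))"
      by (rule sums_Re)
    moreover have "Re (Ln (1 - b * cis (- x))) = ln (cmod (1 - b * cis (- x)))"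
      by (rule Re_Ln[OF nz])
    ultimately show ?thesis
      by (simp add: sums_def)
  qed
  have bound: "norm (?s n x) \<le> 1 / (1 - ?r)" for n x
  proof -
    have "norm (?s n x) \<le> (\<Sum>k<n. ?r ^ k)"
    proof (rule order_trans[OF norm_sum sum_mono])
      fix k
      have "norm (- Re ((b * cis (- x)) ^ k / of_nat k)) \<le> cmod ((b * cis (- x)) ^ k / of_nat k)"
        using abs_Re_le_cmod[of "(b * cis (- x)) ^ k / of_nat k"] by simp
      also have "\<dots> = ?r ^ k / real k" by (simp add: norm_divide norm_power norm_mult)
      also have "\<dots> \<le> ?r ^ k" 
        using mult_right_mono[of 1 "real k" "?r ^ k"] by (cases "k = 0") (auto simp: divide_le_eq mult.commute)
      finally show "norm (- Re ((b * cis (- x)) ^ k / of_nat k)) \<le> ?r ^ k" .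
    qed
    also have "\<dots> \<le> (\<Sum>k. ?r ^ k)"
      using assms by (intro sum_le_suminf summable_geometric) auto
    also have "\<dots> = 1 / (1 - ?r)" using assms by (intro suminf_geometric) simp
    finally show ?thesis .
  qed
  have "(\<lambda>n. Lint (?s n)) \<longlonglongrightarrow> Lint (\<lambda>x. ln (cmod (1 - b * cis (- x))))"
    unfolding Lint_def
  proof (rule integral_dominated_convergence[where w = "\<lambda>_. 1 / (1 - ?r)"])
    show "integrable (lebesgue_on Lam) (\<lambda>_. 1 / (1 - ?r))"
      using L1_const by (simp only: L1_def)
    show "?s n \<in> borel_measurable (lebesgue_on Lam)" for n
      unfolding divide_inverse by (intro measurable_Lam_continuous continuous_intros)
    show "(\<lambda>x. ln (cmod (1 - b * cis (- x)))) \<in> borel_measurable (lebesgue_on Lam)"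
      using L by (auto simp: L1_def)
  qed (use lim bound in auto)
  moreover have "Lint (?s n) = 0" for n
  proof -
    let ?P = "\<Sum>k<n. monom (- (b ^ k) / of_nat k) k"
    have "?s n x = Re (poly ?P (cis (- x)))" for x
      by (simp add: poly_sum poly_monom power_mult_distrib)
    then have "Lint (?s n) = 2 * pi * Re (coeff ?P 0)"
      using Lint_Re_poly[of ?P] by simp
    also have "coeff ?P 0 = 0" by (simp add: coeff_sum)
    finally show ?thesis by simp
  qed
  ultimately have "(\<lambda>n::nat. 0) \<longlonglongrightarrow> Lint (\<lambda>x. ln (cmod (1 - b * cis (- x))))"
    by simp
  then show "Lint (\<lambda>x. ln (cmod (1 - b * cis (- x)))) = 0"
    by (simp add: LIMSEQ_const_iff)
qed

lemma cmod_one_minus_scaled: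
  assumes "cmod w = 1"
  shows "(cmod (1 - of_real r * w))\<^sup>2 = 1 + r\<^sup>2 - 2 * r * Re w"
proof -
  have "(Re w)\<^sup>2 + (Im w)\<^sup>2 = 1" using assms by (simp add: cmod_power2[symmetric])
  then have "r\<^sup>2 * ((Re w)\<^sup>2 + (Im w)\<^sup>2) = r\<^sup>2" by simp
  then show ?thesis
    unfolding cmod_power2 by (simp add: power2_eq_square algebra_simps)
qed

text \<open>For |w| = 1 the quotient |1 - r w|^2 / r = 1/r + r - 2 Re w decreases to |1 - w|^2 as r
  increases to 1, which lets monotone convergence reach the boundary case.\<close>
lemma Lint_ln_circle:
  assumes "cmod b = 1"
  shows "L1 (\<lambda>x. ln (cmod (1 - b * cis (- x))))" "Lint (\<lambda>x. ln (cmod (1 - b * cis (- x)))) = 0"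
proof -
  define r where "r n = 1 - 1 / (real n + 2)" for n
  have r: "0 < r n" "r n < 1" for n by (auto simp: r_def field_simps)
  have r_mono: "r i \<le> r j" if "i \<le> j" for i j
    using that by (auto simp: r_def intro!: divide_left_mono)
  have r_lim: "r \<longlonglongrightarrow> 1"
  proof -
    have "(\<lambda>n. 1 - 1 / real (n + 2)) \<longlonglongrightarrow> 1 - 0"
      by (intro tendsto_diff tendsto_const LIMSEQ_ignore_initial_segment lim_1_over_n)
    then show ?thesis by (simp add: r_def[abs_def] add.commute)
  qed
  let ?w = "\<lambda>x. b * cis (- x)"
  have w: "cmod (?w x) = 1" for x using assms by (simp add: norm_mult)
  \<comment> \<open>Subtracting \<open>ln (r n) / 2\<close> divides the squared modulus by
    \<open>r n\<close>; the minus sign turns the decreasing quotient into an increasing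
    sequence.\<close>
  let ?F = "\<lambda>n x. - (ln (cmod (1 - of_real (r n) * b * cis (- x))) - ln (r n) / 2)"
  let ?u = "\<lambda>x. - ln (cmod (1 - b * cis (- x)))"
  have ri: "cmod (of_real (r n) * b) < 1" for n using r[of n] assms by (simp add: norm_mult)
  note li = Lint_ln_inside[OF ri]
  have Feq: "?F n x = - (ln (1 / r n + r n - 2 * Re (?w x)) / 2)" for n x
  proof -
    let ?c = "cmod (1 - of_real (r n) * ?w x)"
    have "?c > 0"
    proof -
      have "of_real (r n) * ?w x \<noteq> 1"
      proof
        assume "of_real (r n) * ?w x = 1"
        then have "cmod (of_real (r n) * ?w x) = 1" by simp
        then show False using r[of n] w[of x] by (simp add: norm_mult)
      qed
      then show ?thesis by simp
    qed
    then have "ln ?c - ln (r n) / 2 = ln (?c\<^sup>2 / r n) / 2"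
      using r[of n] by (simp add: ln_div ln_realpow field_simps)
    also have "?c\<^sup>2 / r n = 1 / r n + r n - 2 * Re (?w x)"
      using r[of n] unfolding cmod_one_minus_scaled[OF w] by (simp add: field_simps power2_eq_square)
    finally show ?thesis by (simp add: mult.assoc)
  qed
  have pos: "1 / r n + r n - 2 * Re (?w x) > 0" for n x
  proof -
    have "(1 - r n)\<^sup>2 > 0" using r[of n] by simp
    then have "2 < 1 / r n + r n" using r[of n] by (simp add: field_simps power2_eq_square)
    moreover have "Re (?w x) \<le> 1" using complex_Re_le_cmod[of "?w x"] w[of x] by simp
    ultimately show ?thesis by linarith
  qed
  have mono: "mono (\<lambda>n. ?F n x)" for x
  proof (rule monoI)
    fix i j :: nat assume "i \<le> j"
    let ?a = "r i" and ?b = "r j"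
    have ab: "?a \<le> ?b" by (rule r_mono[OF \<open>i \<le> j\<close>])
    have "1 / ?b + ?b \<le> 1 / ?a + ?a"
    proof -
      have "?a * ?b < 1" using r[of i] r[of j] by (simp add: mult_strict_mono[of ?a 1 ?b 1, simplified])
      then have "0 \<le> (?b - ?a) * (1 - ?a * ?b)" using ab by simp
      then show ?thesis using r(1)[of i] r(1)[of j] by (simp add: field_simps power2_eq_square)
    qed
    then show "?F i x \<le> ?F j x"
      unfolding Feq using pos[of i x] pos[of j x] by simp
  qed
  have lim: "AE x in lebesgue_on Lam. (\<lambda>n. ?F n x) \<longlonglongrightarrow> ?u x"
    using AE_cis_neq[of b]
  proof eventually_elim
    case (elim x)
    have "(\<lambda>n. ?F n x) \<longlonglongrightarrow> - (ln (cmod (1 - of_real 1 * b * cis (- x))) - ln 1 / 2)"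
      using elim by (intro tendsto_intros r_lim) auto
    then show ?case by simp
  qed
  have F: "L1 (?F n)" "Lint (?F n) = pi * ln (r n)" for n
  proof -
    let ?l = "\<lambda>x. ln (cmod (1 - of_real (r n) * b * cis (- x)))"
    have eq: "?F n = (\<lambda>x. ln (r n) / 2 - ?l x)" by auto
    show "L1 (?F n)" unfolding eq by (intro L1_diff L1_const li(1))
    show "Lint (?F n) = pi * ln (r n)"
      unfolding eq Lint_diff[OF L1_const li(1)] li(2) by simp
  qed
  have "(\<lambda>n. pi * ln (r n)) \<longlonglongrightarrow> pi * ln 1"
    by (intro tendsto_intros r_lim) auto
  then have ilim: "(\<lambda>n. integral\<^sup>L (lebesgue_on Lam) (?F n)) \<longlonglongrightarrow> 0"
    using F(2) by (simp add: Lint_def)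
  have "(\<lambda>x. 1 - b * cis (- x)) \<in> borel_measurable (lebesgue_on Lam)"
    by (intro continuous_imp_measurable_on_sets_lebesgue continuous_intros) simp
  then have meas: "?u \<in> borel_measurable (lebesgue_on Lam)" by measurable
  \<comment> \<open>Monotone convergence with convergent integrals supplies both the integrability
    of the limit and its integral.\<close>
  have "integrable (lebesgue_on Lam) ?u" "integral\<^sup>L (lebesgue_on Lam) ?u = 0"
    using integrable_monotone_convergence[OF F(1)[unfolded L1_def] AE_I2[OF mono] lim ilim meas]
      integral_monotone_convergence[OF F(1)[unfolded L1_def] AE_I2[OF mono] lim ilim meas] by auto
  then show "L1 (\<lambda>x. ln (cmod (1 - b * cis (- x))))" "Lint (\<lambda>x. ln (cmod (1 - b * cis (- x)))) = 0"
    by (auto simp: L1_def Lint_def)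
qed

lemma Lint_ln_linear:
  assumes "cmod b \<le> 1"
  shows "L1 (\<lambda>x. ln (cmod (1 - b * cis (- x))))" "Lint (\<lambda>x. ln (cmod (1 - b * cis (- x)))) = 0"
  using assms Lint_ln_inside[of b] Lint_ln_circle[of b] by (cases "cmod b < 1"; force)+

lemma linear_factor_powr:
  assumes "cmod b \<le> 1"
  shows "\<beta> \<ge> 0 \<Longrightarrow> admissible (\<lambda>x. cmod (1 - b * cis (- x)) powr \<beta>)"
    and "G (\<lambda>x. cmod (1 - b * cis (- x)) powr \<beta>) = 1"
proof -
  let ?p = "\<lambda>x. cmod (1 - b * cis (- x))"
  have pos: "AE x in lebesgue_on Lam. ?p x powr \<beta> > 0"
    using AE_cis_neq[of b] by eventually_elim auto
  \<comment> \<open>As an equality of functions this includes the zeros of \<open>?p\<close>, where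
    both sides are 0.\<close>
  have ln: "(\<lambda>x. ln (?p x powr \<beta>)) = (\<lambda>x. \<beta> * ln (?p x))"
    by (auto simp: ln_powr)
  have L1: "L1 (\<lambda>x. ln (?p x powr \<beta>))"
    unfolding ln by (intro L1_cmult Lint_ln_linear assms)
  show "G (\<lambda>x. ?p x powr \<beta>) = 1"
    using pos L1 by (simp add: G_def ln Lint_cmult Lint_ln_linear(2)[OF assms])
  have c: "continuous_on Lam ?p" by (intro continuous_intros)
  have meas: "?p \<in> borel_measurable (lebesgue_on Lam)"
    by (rule measurable_Lam_continuous[OF c])
  have "?p x powr \<beta> \<le> 2 powr \<beta>" if "\<beta> \<ge> 0" for x
  proof (rule powr_mono2[OF that])
    show "?p x \<le> 2" using norm_triangle_ineq4[of 1 "b * cis (- x)"] assms by (simp add: norm_mult)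
  qed simp
  then show "admissible (\<lambda>x. ?p x powr \<beta>)" if "\<beta> \<ge> 0"
    using pos L1 meas that by (auto simp: admissible_def)
qed

text \<open>When \<open>cmod b = 1\<close> no positive continuous function lies below
  \<open>?g\<close>, so \<open>multiplier_sandwich\<close> cannot give the lower limit. Instead the
  polynomial \<open>[:1, - b:]\<close> supplies the square that compensates the negative power
  \<beta> - 2 of the regularized factor \<open>q\<close>.\<close>

lemma multiplier_linear_factor_small:
  assumes b: "cmod b \<le> 1" and \<beta>: "0 < \<beta>" "\<beta> \<le> 2"
  shows "multiplier (\<lambda>x. cmod (1 - b * cis (- x)) powr \<beta>)"
proof -
  let ?p = "\<lambda>x. cmod (1 - b * cis (- x))"
  let ?g = "\<lambda>x. ?p x powr \<beta>"
  have adm: "admissible ?g" and G: "G ?g = 1"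
    using linear_factor_powr[OF b, of \<beta>] \<beta> by auto
  \<comment> \<open>The added term makes \<open>q n\<close> positive, so that all its real powers,
    negative ones included, are continuous multipliers.\<close>
  define q where "q n z = cmod (1 - b * z) + 1 / real (Suc n)" for n z
  have qpos: "q n z > 0" for n z by (simp add: q_def add_nonneg_pos)
  have qcont: "continuous_on S (q n)" for S n unfolding q_def by (intro continuous_intros)
  have qcont': "continuous_on S (\<lambda>x. q n (cis (- x)))" for S n unfolding q_def by (intro continuous_intros)
  have q_ge: "?p x \<le> q n (cis (- x))" for n x by (simp add: q_def)
  have mult: "multiplier (\<lambda>x. q n (cis (- x)) powr \<gamma>)" for n \<gamma>
    using qpos by (intro multiplier_continuous_circle continuous_intros qcont) (auto simp: less_imp_neq[symmetric])
  have lim: "(\<lambda>n. G (\<lambda>x. q n (cis (- x)) powr \<gamma>)) \<longlonglongrightarrow> 1" for \<gamma>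
  proof -
    let ?l = "\<lambda>n x. ln (q n (cis (- x)))"
    have "(\<lambda>n. Lint (?l n)) \<longlonglongrightarrow> Lint (\<lambda>x. ln (?p x))"
      unfolding Lint_def
    \<comment> \<open>The logarithm of \<open>q\<close> lies between \<open>ln (?p x)\<close> and
      \<open>ln 3\<close>, since \<open>?p x \<le> 2\<close> and the added term is at most
      1.\<close>
    proof (rule integral_dominated_convergence[where w = "\<lambda>x. \<bar>ln (?p x)\<bar> + ln 3"])
      show "integrable (lebesgue_on Lam) (\<lambda>x. \<bar>ln (?p x)\<bar> + ln 3)"
        using Lint_ln_linear(1)[OF b] L1_const[of "ln 3"] by (simp only: L1_def integrable_abs Bochner_Integration.integrable_add)
      show "(\<lambda>x. ln (?p x)) \<in> borel_measurable (lebesgue_on Lam)"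
        using Lint_ln_linear(1)[OF b] by (auto simp: L1_def)
      show "?l n \<in> borel_measurable (lebesgue_on Lam)" for n
        using qpos by (intro measurable_Lam_continuous continuous_intros qcont') (auto simp: less_imp_neq[symmetric])
      show "AE x in lebesgue_on Lam. (\<lambda>n. ?l n x) \<longlonglongrightarrow> ln (?p x)"
        using AE_cis_neq[of b]
      proof eventually_elim
        case (elim x)
        have "(\<lambda>n. q n (cis (- x))) \<longlonglongrightarrow> ?p x + 0"
          unfolding q_def by (intro tendsto_add tendsto_const LIMSEQ_Suc[OF lim_1_over_n])
        then show ?case using elim by (intro tendsto_ln) auto
      qed
      show "AE x in lebesgue_on Lam. norm (?l n x) \<le> \<bar>ln (?p x)\<bar> + ln 3" for n
        using AE_cis_neq[of b]
      proof eventually_elim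
        case (elim x)
        then have p: "?p x > 0" by auto
        have "?p x \<le> 2" using norm_triangle_ineq4[of 1 "b * cis (- x)"] b by (simp add: norm_mult)
        moreover have "1 / real (Suc n) \<le> 1" by simp
        ultimately have "q n (cis (- x)) \<le> 3" unfolding q_def by linarith
        then have "?l n x \<le> ln 3" using qpos[of n "cis (- x)"] by simp
        moreover have "ln (?p x) \<le> ?l n x" using p q_ge by (intro ln_mono) auto
        moreover have "0 \<le> ln (3::real)" by simp
        ultimately show ?case unfolding real_norm_def by linarith
      qed
    qed
    then have "(\<lambda>n. exp (1 / (2 * pi) * (\<gamma> * Lint (?l n)))) \<longlonglongrightarrow> exp (1 / (2 * pi) * (\<gamma> * 0))"
      unfolding Lint_ln_linear(2)[OF b] by (intro tendsto_intros)
    moreover have "G (\<lambda>x. q n (cis (- x)) powr \<gamma>) = exp (1 / (2 * pi) * (\<gamma> * Lint (?l n)))" for n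
    proof -
      have "admissible (\<lambda>x. q n (cis (- x)) powr \<gamma>)" using mult[of n \<gamma>] by (simp add: multiplier_def)
      from admissibleD(6)[OF this] show ?thesis
        using qpos by (simp add: ln_powr Lint_cmult less_imp_neq[symmetric])
    qed
    ultimately show ?thesis by simp
  qed
  show ?thesis
    unfolding multiplier_def
  proof (intro conjI allI impI adm)
    fix f assume f: "classF f"
    note F = classF_D[OF f]
    have w: "L1 (\<lambda>x. f x * ?g x)" "\<And>x. x \<in> Lam \<Longrightarrow> 0 \<le> f x * ?g x"
      using F(2) by (auto intro: L1_mult_admissible[OF F(1) adm])
    show "(\<lambda>n. sigma2 (\<lambda>x. f x * ?g x) n / sigma2 f n) \<longlonglongrightarrow> G ?g"
      unfolding G
    proof (rule order_tendstoI)
      fix a :: real assume a: "a < 1"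
      \<comment> \<open>The target is split as \<open>a' * c = max a 0\<close> with both factors
        below 1: \<open>c\<close> is for passing from \<open>f\<close> to
        \<open>f * ?\<psi> N\<close>, and \<open>a'\<close> for passing from there to
        \<open>f * ?g\<close>.\<close>
      define c where "c = (1 + max a 0) / 2"
      have c: "0 < c" "c < 1" "a < c" using a by (auto simp: c_def)
      define a' where "a' = max a 0 / c"
      have a': "a' < 1" "a \<le> a' * c" using c a by (auto simp: a'_def c_def field_simps)
      let ?\<psi> = "\<lambda>n x. q n (cis (- x)) powr (\<beta> - 2)"
      have "eventually (\<lambda>n. c < G (?\<psi> n)) sequentially"
        by (rule order_tendstoD(1)[OF lim c(2)])
      then obtain N where N: "c < G (?\<psi> N)" by (auto simp: eventually_sequentially)
      have f\<psi>: "classF (\<lambda>x. f x * ?\<psi> N x)" by (rule multiplier_classF[OF mult f])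
      have "(\<lambda>n. sigma2 (\<lambda>x. f x * ?\<psi> N x) n / sigma2 f n) \<longlonglongrightarrow> G (?\<psi> N)"
        using mult f by (simp add: multiplier_def)
      then have 1: "eventually (\<lambda>n. c < sigma2 (\<lambda>x. f x * ?\<psi> N x) n / sigma2 f n) sequentially"
        using N by (rule order_tendstoD(1))
      have 2: "eventually (\<lambda>n. a' < sigma2 (\<lambda>x. f x * ?g x) n / sigma2 (\<lambda>x. f x * ?\<psi> N x) n) sequentially"
      proof (rule sigma2_ratio_lower[OF f\<psi> w(1), where p = "[:1, - b:]" and K = 1])
        fix x assume x: "x \<in> Lam"
        have "?\<psi> N x * (?p x)\<^sup>2 \<le> ?g x"
        proof (cases "?p x = 0")
          case False
          then have p: "?p x > 0" by simp
          have "?\<psi> N x \<le> ?p x powr (\<beta> - 2)"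
            using p \<beta> q_ge by (intro powr_mono2') auto
          then have "?\<psi> N x * (?p x)\<^sup>2 \<le> ?p x powr (\<beta> - 2) * (?p x)\<^sup>2"
            by (rule mult_right_mono) simp
          also have "\<dots> = ?p x powr (\<beta> - 2) * ?p x powr 2" using p by (simp add: powr_numeral)
          also have "\<dots> = ?g x" by (simp only: powr_add[symmetric] diff_add_cancel)
          finally show ?thesis .
        qed simp
        from mult_left_mono[OF this F(2)[OF x]]
        show "f x * ?\<psi> N x * (cmod (poly [:1, - b:] (cis (- x))))\<^sup>2 \<le> 1 * (f x * ?g x)"
          by (simp add: mult.commute mult.left_commute)
      qed (use a' in auto)
      show "eventually (\<lambda>n. a < sigma2 (\<lambda>x. f x * ?g x) n / sigma2 f n) sequentially"
        using 1 2 classF_sigma2_pos[OF f] classF_sigma2_pos[OF f\<psi>]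
      proof eventually_elim
        case (elim n)
        have "a \<le> a' * c" by (rule a')
        also have "\<dots> < sigma2 (\<lambda>x. f x * ?g x) n / sigma2 (\<lambda>x. f x * ?\<psi> N x) n
            * (sigma2 (\<lambda>x. f x * ?\<psi> N x) n / sigma2 f n)"
          using elim c by (intro mult_strict_mono') (auto simp: a'_def)
        also have "\<dots> = sigma2 (\<lambda>x. f x * ?g x) n / sigma2 f n" using elim by simp
        finally show ?case .
      qed
    next
      fix a :: real assume a: "1 < a"
      let ?\<psi> = "\<lambda>n x. q n (cis (- x)) powr \<beta>"
      have "eventually (\<lambda>n. G (?\<psi> n) < a) sequentially"
        by (rule order_tendstoD(2)[OF lim a])
      then obtain N where N: "G (?\<psi> N) < a" by (auto simp: eventually_sequentially)
      have adm\<psi>: "admissible (?\<psi> N)"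
        and "(\<lambda>n. sigma2 (\<lambda>x. f x * ?\<psi> N x) n / sigma2 f n) \<longlonglongrightarrow> G (?\<psi> N)"
        using mult f by (simp_all add: multiplier_def)
      then have "eventually (\<lambda>n. sigma2 (\<lambda>x. f x * ?\<psi> N x) n / sigma2 f n < a) sequentially"
        using N by (auto dest: order_tendstoD(2))
      then show "eventually (\<lambda>n. sigma2 (\<lambda>x. f x * ?g x) n / sigma2 f n < a) sequentially"
        using classF_sigma2_pos[OF f]
      proof eventually_elim
        case (elim n)
        have "sigma2 (\<lambda>x. f x * ?g x) n \<le> sigma2 (\<lambda>x. f x * ?\<psi> N x) n"
          using \<beta> q_ge by (intro sigma2_mono w L1_mult_admissible[OF F(1) adm\<psi>] mult_left_mono powr_mono2 F(2)) auto
        then have "sigma2 (\<lambda>x. f x * ?g x) n / sigma2 f n \<le> sigma2 (\<lambda>x. f x * ?\<psi> N x) n / sigma2 f n"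
          using elim by (intro divide_right_mono) auto
        with elim show ?case by linarith
      qed
    qed
  qed
qed

section \<open>Products and trigonometric polynomials\<close>

lemma multiplier_const: "c > 0 \<Longrightarrow> multiplier (\<lambda>x. c)"
  using multiplier_continuous_circle[of "\<lambda>_. c"] by simp

lemma multiplier_prod:
  assumes "finite A" "\<And>i. i \<in> A \<Longrightarrow> multiplier (g i)"
  shows "multiplier (\<lambda>x. \<Prod>i\<in>A. g i x)"
  using assms by (induction A rule: finite_induct) (auto intro: multiplier_const multiplier_mult)

text \<open>A large exponent is cut into \<open>N\<close> equal parts, each at most 1 and so within
  reach of \<open>multiplier_linear_factor_small\<close>.\<close>

lemma multiplier_linear_factor:
  assumes b: "cmod b \<le> 1" and \<beta>: "0 < \<beta>"
  shows "multiplier (\<lambda>x. cmod (1 - b * cis (- x)) powr \<beta>)"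
proof -
  obtain N :: nat where N: "\<beta> \<le> real N" using real_arch_simple by blast
  then have N0: "N > 0" using \<beta> by (cases N) auto
  have "multiplier (\<lambda>x. \<Prod>i<N. cmod (1 - b * cis (- x)) powr (\<beta> / N))"
    using N N0 \<beta> by (intro multiplier_prod multiplier_linear_factor_small[OF b]) (auto simp: field_simps)
  moreover have "(\<Prod>i<N. cmod (1 - b * cis (- x)) powr (\<beta> / N)) = cmod (1 - b * cis (- x)) powr \<beta>" for x
    using N0 by (cases "1 - b * cis (- x) = 0") (simp_all add: powr_power)
  ultimately show ?thesis by simp
qed

text \<open>On the circle a zero inside the disc can be reflected to the outside: |z - r| = |1 - cnj r z|.\<close>
lemma circle_linear_factor:
  "\<exists>c b. c > 0 \<and> cmod b \<le> 1 \<and> (\<forall>z\<in>unit_circle. cmod (z - r) = c * cmod (1 - b * z))"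
proof (cases "cmod r \<le> 1")
  case True
  have "cmod (z - r) = 1 * cmod (1 - cnj r * z)" if z: "z \<in> unit_circle" for z
  proof -
    have zz: "z * cnj z = 1" using z by (simp add: complex_norm_square[symmetric])
    have "cmod (1 - cnj r * z) = cmod (z * cnj z - cnj r * z)" by (simp only: zz)
    also have "\<dots> = cmod (z * cnj (z - r))" by (simp add: algebra_simps)
    also have "\<dots> = cmod (z - r)" using z by (simp only: norm_mult complex_mod_cnj) simp
    finally show ?thesis by simp
  qed
  then show ?thesis using True by (intro exI[of _ 1] exI[of _ "cnj r"]) auto
next
  case False
  then have r: "r \<noteq> 0" "cmod r > 1" by auto
  have "cmod (z - r) = cmod r * cmod (1 - 1 / r * z)" for z
  proof -
    have "z - r = - (r * (1 - 1 / r * z))" using r by (simp add: field_simps)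
    then show ?thesis by (metis norm_minus_cancel norm_mult)
  qed
  then show ?thesis using r
    by (intro exI[of _ "cmod r"] exI[of _ "1 / r"]) (auto simp: norm_divide)
qed

text \<open>Up to a unimodular factor, \<open>t\<close> is a polynomial in \<open>cis (- x)\<close>.
  It splits over the complex numbers, and \<open>circle_linear_factor\<close> normalizes each
  root.\<close>

lemma trig_poly_factorization:
  assumes "trig_poly t" "\<exists>x\<in>Lam. t x \<noteq> 0"
  obtains C b and N :: nat where "C > 0" "\<And>i. cmod (b i) \<le> 1"
    "\<And>x. cmod (t x) = C * (\<Prod>i<N. cmod (1 - b i * cis (- x)))"
proof -
  obtain \<nu> :: nat and c where t: "\<And>x. t x = (\<Sum>k \<in> {-int \<nu>..int \<nu>}. c k * exp (\<i> * of_int k * of_real x))"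
    using assms(1) by (auto simp: trig_poly_def)
  \<comment> \<open>The order of the coefficients is reversed because the variable is
    \<open>cis (- x)\<close>: frequency \<nu> - j becomes the power \<open>j\<close> after the
    factor \<open>cis (\<nu> * x)\<close> is taken out.\<close>
  define q where "q = (\<Sum>j\<le>2 * \<nu>. monom (c (int \<nu> - int j)) j)"
  have tq: "cmod (t x) = cmod (poly q (cis (- x)))" for x
  proof -
    have "t x = (\<Sum>j\<le>2 * \<nu>. c (int \<nu> - int j) * exp (\<i> * of_int (int \<nu> - int j) * of_real x))"
      unfolding t
      by (rule sum.reindex_bij_witness[of _ "\<lambda>j. int \<nu> - int j" "\<lambda>k. nat (int \<nu> - k)"]) auto
    also have "\<dots> = (\<Sum>j\<le>2 * \<nu>. cis (real \<nu> * x) * (c (int \<nu> - int j) * cis (- x) ^ j))"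
    proof (rule sum.cong[OF refl])
      fix j
      have "exp (\<i> * of_int (int \<nu> - int j) * of_real x) = cis (real \<nu> * x) * cis (- x) ^ j"
        by (simp add: cis_conv_exp exp_of_nat_mult[symmetric] exp_add[symmetric] algebra_simps)
      then show "c (int \<nu> - int j) * exp (\<i> * of_int (int \<nu> - int j) * of_real x)
          = cis (real \<nu> * x) * (c (int \<nu> - int j) * cis (- x) ^ j)" by simp
    qed
    also have "\<dots> = cis (real \<nu> * x) * poly q (cis (- x))"
      by (simp add: q_def poly_sum poly_monom sum_distrib_left)
    finally show ?thesis by (simp add: norm_mult)
  qed
  have q0: "q \<noteq> 0" using assms(2) tq by auto
  obtain root where root: "smult (lead_coeff q) (\<Prod>i<degree q. [:- root i, 1:]) = q"
    by (rule complex_poly_decompose')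
  have "\<forall>i. \<exists>c b. c > 0 \<and> cmod b \<le> 1 \<and> (\<forall>z\<in>unit_circle. cmod (z - root i) = c * cmod (1 - b * z))"
    using circle_linear_factor by blast
  then obtain d b where db: "\<And>i. d i > 0" "\<And>i. cmod (b i) \<le> 1"
      "\<And>i z. z \<in> unit_circle \<Longrightarrow> cmod (z - root i) = d i * cmod (1 - b i * z)"
    by metis
  let ?C = "cmod (lead_coeff q) * (\<Prod>i<degree q. d i)"
  have "cmod (t x) = ?C * (\<Prod>i<degree q. cmod (1 - b i * cis (- x)))" for x
  proof -
    have "poly q (cis (- x)) = lead_coeff q * (\<Prod>i<degree q. (cis (- x) - root i))"
      by (subst root[symmetric]) (simp add: poly_prod)
    then have "cmod (t x) = cmod (lead_coeff q) * (\<Prod>i<degree q. cmod (cis (- x) - root i))"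
      by (simp add: tq norm_mult prod_norm)
    also have "\<dots> = cmod (lead_coeff q) * (\<Prod>i<degree q. d i * cmod (1 - b i * cis (- x)))"
      by (simp add: db(3))
    finally show ?thesis by (simp add: prod.distrib mult.assoc)
  qed
  moreover have "?C > 0" using q0 db(1) by (auto intro!: mult_pos_pos prod_pos)
  ultimately show ?thesis using that[of ?C b "degree q"] db(2) by simp
qed

lemma multiplier_trig_poly_powr:
  assumes "trig_poly t" "\<exists>x\<in>Lam. t x \<noteq> 0" "\<alpha> > 0"
  shows "multiplier (\<lambda>x. cmod (t x) powr \<alpha>)"
proof -
  obtain C b and N :: nat where C: "C > 0" "\<And>i. cmod (b i) \<le> 1"
      "\<And>x. cmod (t x) = C * (\<Prod>i<N. cmod (1 - b i * cis (- x)))"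
    using trig_poly_factorization[OF assms(1,2)] by metis
  have "cmod (t x) powr \<alpha> = C powr \<alpha> * (\<Prod>i<N. cmod (1 - b i * cis (- x)) powr \<alpha>)" for x
    unfolding C(3) using C(1) by (simp add: powr_mult prod_nonneg prod_powr_distrib)
  moreover have "multiplier (\<lambda>x. C powr \<alpha> * (\<Prod>i<N. cmod (1 - b i * cis (- x)) powr \<alpha>))"
    using C assms(3) by (intro multiplier_mult multiplier_const multiplier_prod multiplier_linear_factor) auto
  ultimately show ?thesis by simp
qed

text \<open>The case \<open>m = 1\<close> is the assertion for a single trigonometric
  polynomial.\<close>

theorem mainTheorem12:
  fixes f h :: "real \<Rightarrow> real" and m :: nat
    and t :: "nat \<Rightarrow> real \<Rightarrow> complex" and \<alpha> :: "nat \<Rightarrow> real"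
  assumes "classF f"
    and "classBpm h"
    and "m \<ge> 1"
    and "\<forall>j\<in>{1..m}. trig_poly (t j) \<and> (\<exists>x\<in>Lam. t j x \<noteq> 0) \<and> \<alpha> j > 0"
  shows "classM f (\<lambda>x. h x * (\<Prod>j = 1..m. cmod (t j x) powr \<alpha> j))
       \<and> classF (\<lambda>x. f x * (h x * (\<Prod>j = 1..m. cmod (t j x) powr \<alpha> j)))
       \<and> (\<lambda>n. sigma2 (\<lambda>x. f x * (h x * (\<Prod>j = 1..m. cmod (t j x) powr \<alpha> j))) n / sigma2 f n)
            \<longlonglongrightarrow> G (\<lambda>x. h x * (\<Prod>j = 1..m. cmod (t j x) powr \<alpha> j))"
proof -
  have "multiplier (\<lambda>x. h x * (\<Prod>j = 1..m. cmod (t j x) powr \<alpha> j))"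
    using assms(2,4)
    by (intro multiplier_mult multiplier_classBpm multiplier_prod multiplier_trig_poly_powr) auto
  from multiplier_classM[OF this assms(1)] multiplier_classF[OF this assms(1)]
  show ?thesis by (simp add: classM_def)
qed

end
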